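(* For every $\delta > 0$ there exists $n_0$ such that for all $n \geq n_0$ the following holds. Let $G$ be a multigraph whose edges are coloured with $n$ colours, such that for each colour, the subgraph formed by the edges of that colour (its colour class) is a vertex-disjoint union of non-trivial cliques and has at least $(2+\delta)n$ vertices. If every pair of vertices of $G$ is joined by at most $\frac{\sqrt{n}}{\log^2 n}$ edges, then $G$ contains a full rainbow matching.
   Context: The colour class of a colour $c$ is the graph whose edges are the edges of $G$ of colour $c$ and whose vertices are the vertices incident to at least one such edge; a non-trivial clique is a complete graph on at least two vertices. A full rainbow matching is a set of $n$ pairwise vertex-disjoint edges of $G$ whose colours are all distinct, i.e. each of the $n$ colours appears exactly once. *)

theory Defs
  imports Complex_Main "HOL-Library.Disjoint_Sets"
begin

text \<open>
  Undirected multigraphs: edges are objects of their own, and \<open>ends\<close> maps an edge to the set of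
  its two end vertices, so that several edges may join the same pair of vertices.
\<close>

record ('v, 'e) pre_multigraph =
  verts :: "'v set"
  edges :: "'e set"
  ends :: "'e \<Rightarrow> 'v set"

locale multigraph =
  fixes G :: "('v, 'e) pre_multigraph"
  assumes finite_verts: "finite (verts G)"
    and finite_edges: "finite (edges G)"
    and ends_subset_verts: "e \<in> edges G \<Longrightarrow> ends G e \<subseteq> verts G"
    and card_ends: "e \<in> edges G \<Longrightarrow> card (ends G e) = 2"

definition edges_joining :: "('v, 'e) pre_multigraph \<Rightarrow> 'v \<Rightarrow> 'v \<Rightarrow> 'e set" where
  "edges_joining G u v = {e \<in> edges G. ends G e = {u, v}}"

text \<open>A clique is a complete (simple) graph: parallel edges are excluded.\<close>

definition nontrivial_clique :: "('v, 'e) pre_multigraph \<Rightarrow> bool" where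
  "nontrivial_clique K \<longleftrightarrow> multigraph K \<and> 2 \<le> card (verts K) \<and>
     (\<forall>u \<in> verts K. \<forall>v \<in> verts K. u \<noteq> v \<longrightarrow> (\<exists>!e. e \<in> edges_joining K u v))"

definition is_disjoint_union ::
  "('v, 'e) pre_multigraph \<Rightarrow> ('v, 'e) pre_multigraph set \<Rightarrow> bool" where
  "is_disjoint_union H \<K> \<longleftrightarrow> (\<forall>K \<in> \<K>. ends K = ends H) \<and> disjoint_family_on verts \<K> \<and>
     verts H = (\<Union>K \<in> \<K>. verts K) \<and> edges H = (\<Union>K \<in> \<K>. edges K)"

definition disjoint_union_of_nontrivial_cliques :: "('v, 'e) pre_multigraph \<Rightarrow> bool" where
  "disjoint_union_of_nontrivial_cliques H \<longleftrightarrow>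
     (\<exists>\<K>. is_disjoint_union H \<K> \<and> (\<forall>K \<in> \<K>. nontrivial_clique K))"

definition colour_class ::
  "('v, 'e) pre_multigraph \<Rightarrow> ('e \<Rightarrow> 'c) \<Rightarrow> 'c \<Rightarrow> ('v, 'e) pre_multigraph" where
  "colour_class G col c =
     \<lparr>verts = (\<Union>e \<in> {e \<in> edges G. col e = c}. ends G e),
      edges = {e \<in> edges G. col e = c},
      ends = ends G\<rparr>"

definition full_rainbow_matching ::
  "('v, 'e) pre_multigraph \<Rightarrow> ('e \<Rightarrow> 'c) \<Rightarrow> nat \<Rightarrow> 'e set \<Rightarrow> bool" where
  "full_rainbow_matching G col n M \<longleftrightarrow>
     M \<subseteq> edges G \<and> card M = n \<and> disjoint_family_on (ends G) M \<and> inj_on col M"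

end

theory Submission
  imports Defs "HOL-Real_Asymp.Real_Asymp"
begin

text \<open>
  Take a maximum rainbow matching \<open>M\<close>. Call a vertex or colour free if it is unused by \<open>M\<close>, or if it can
  be made unused by boundedly many exchanges. No edge of a free colour joins two free vertices, as
  otherwise \<open>M\<close> could be enlarged. So free vertices of a free colour lie in distinct cliques and send
  disjoint edges to the other matched vertices. An edge of \<open>M\<close> one of whose ends receives many such
  edges can be exchanged for any of them, which frees its other end and its colour. Since a colour
  class has \<open>(2 + \<delta>) n\<close> vertices, each round frees at least \<open>\<delta> n / 2\<close> further vertices unless only
  \<open>O(\<mu>)\<close> colours are missing, where \<open>\<mu>\<close> is the maximal multiplicity; so after \<open>O(1 / \<delta>)\<close> rounds the
  missing colours number \<open>O(\<mu>) = o(n)\<close>.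

  To place these as well, set aside a random set \<open>R\<close> of vertices of small constant density. By
  exponential moments, every colour keeps \<open>(2 + \<delta> / 2) n\<close> vertices outside \<open>R\<close> and has linearly many
  disjoint edges inside \<open>R\<close>. The argument above applies outside \<open>R\<close>, and the missing colours are
  then matched greedily inside \<open>R\<close>.
\<close>

subsection \<open>Switching in hypergraphs\<close>

text \<open>
  A robust \<open>x\<close> can be re-matched through \<open>F\<close> whatever \<open>b\<close> elements have to be avoided. If \<open>x\<close> lies in
  an edge \<open>h\<close> of \<open>M\<close>, re-matching it frees the rest of \<open>h\<close>; elements of \<open>freeable H W M b i\<close> are those
  that \<open>i\<close> nested rounds of such exchanges, with pivots in \<open>W\<close>, can leave uncovered.
\<close>

definition robust :: "'a set set \<Rightarrow> nat \<Rightarrow> 'a set \<Rightarrow> 'a \<Rightarrow> bool" where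
  "robust H b F x \<longleftrightarrow>
     (\<forall>B. finite B \<longrightarrow> card B \<le> b \<longrightarrow> (\<exists>f \<in> H. x \<in> f \<and> f - {x} \<subseteq> F - B))"

fun freeable :: "'a set set \<Rightarrow> 'a set \<Rightarrow> 'a set set \<Rightarrow> nat \<Rightarrow> nat \<Rightarrow> 'a set" where
  "freeable H W M b 0 = - \<Union>M"
| "freeable H W M b (Suc i) =
     - \<Union>M \<union> {y. \<exists>h \<in> M. \<exists>x \<in> h \<inter> W. robust H b (freeable H W M b i) x \<and> y \<in> h - {x}}"

definition max_matching :: "'a set set \<Rightarrow> 'a set set \<Rightarrow> bool" where
  "max_matching H M \<longleftrightarrow> finite H \<and> (\<forall>h \<in> H. card h = 3) \<and> M \<subseteq> H \<and> disjoint M \<and>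
     (\<forall>N. N \<subseteq> H \<longrightarrow> disjoint N \<longrightarrow> card N \<le> card M)"

text \<open>
  \<open>N\<close> is an intermediate stage of the exchanges: it keeps \<open>K\<close>, leaves \<open>A\<close> uncovered, and agrees with
  \<open>M\<close> around \<open>U\<close>, the set to be freed next.
\<close>

definition switchable ::
  "'a set set \<Rightarrow> 'a set set \<Rightarrow> 'a set \<Rightarrow> nat \<Rightarrow> nat \<Rightarrow> nat \<Rightarrow> bool" where
  "switchable H M F r t s \<longleftrightarrow>
     (\<forall>N K A U. N \<subseteq> H \<longrightarrow> disjoint N \<longrightarrow> card N = card M \<longrightarrow> card (N - M) \<le> t \<longrightarrow>
        K \<subseteq> N \<longrightarrow> card K \<le> t \<longrightarrow>
        finite A \<longrightarrow> card A \<le> t \<longrightarrow> A \<inter> \<Union>N = {} \<longrightarrow>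
        finite U \<longrightarrow> card U \<le> t \<longrightarrow> U \<subseteq> F \<longrightarrow>
        U \<inter> \<Union>(N - M) = {} \<longrightarrow> U \<inter> \<Union>(M - N) = {} \<longrightarrow> U \<inter> \<Union>K = {} \<longrightarrow>
        card {h \<in> M. h \<inter> U \<noteq> {}} \<le> r \<longrightarrow>
        (\<exists>N'. N' \<subseteq> H \<and> disjoint N' \<and> card N' = card M \<and> card (N' - M) \<le> s \<and>
           K \<subseteq> N' \<and> (A \<union> U) \<inter> \<Union>N' = {}))"

section \<open>Elimination rules and elementary facts on disjoint families\<close>

lemma switchableD:
  assumes "switchable H M F r t s"
    and "N \<subseteq> H" "disjoint N" "card N = card M" "card (N - M) \<le> t"
    and "K \<subseteq> N" "card K \<le> t" "finite A" "card A \<le> t" "A \<inter> \<Union>N = {}"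
    and "finite U" "card U \<le> t" "U \<subseteq> F" "U \<inter> \<Union>(N - M) = {}" "U \<inter> \<Union>(M - N) = {}"
      "U \<inter> \<Union>K = {}" "card {h \<in> M. h \<inter> U \<noteq> {}} \<le> r"
  shows "\<exists>N'. N' \<subseteq> H \<and> disjoint N' \<and> card N' = card M \<and> card (N' - M) \<le> s \<and>
     K \<subseteq> N' \<and> (A \<union> U) \<inter> \<Union>N' = {}"
  using assms(1)[unfolded switchable_def, rule_format, OF assms(2-)] .

lemma robustD:
  assumes "robust H b F x" "finite B" "card B \<le> b"
  obtains f where "f \<in> H" "x \<in> f" "f - {x} \<subseteq> F" "(f - {x}) \<inter> B = {}"
proof -
  obtain f where "f \<in> H" "x \<in> f" "f - {x} \<subseteq> F - B"
    using assms(1)[unfolded robust_def, rule_format, OF assms(2,3)] by blast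
  then show thesis using that[of f] by blast
qed

lemma disjoint_insertI:
  assumes "disjoint N" "f \<inter> \<Union>N = {}"
  shows "disjoint (insert f N)"
proof (rule disjointI)
  fix a b assume ab: "a \<in> insert f N" "b \<in> insert f N" "a \<noteq> b"
  show "a \<inter> b = {}"
  proof (cases "a \<in> N \<and> b \<in> N")
    case True
    then show ?thesis using disjointD[OF assms(1)] ab(3) by simp
  next
    case False
    then show ?thesis using ab assms(2) by auto
  qed
qed

lemma disjoint_eqI:
  assumes "disjoint N" "g \<in> N" "h \<in> N" "x \<in> g" "x \<in> h"
  shows "g = h"
  using disjointD[OF assms(1-3)] assms(4,5) by blast

lemma max_matchingD:
  assumes "max_matching H M"
  shows "finite H" "h \<in> H \<Longrightarrow> card h = 3" "h \<in> H \<Longrightarrow> finite h" "h \<in> H \<Longrightarrow> h \<noteq> {}"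
    "M \<subseteq> H" "disjoint M" "finite M"
    "N \<subseteq> H \<Longrightarrow> disjoint N \<Longrightarrow> card N \<le> card M"
proof -
  have c: "card h = 3" if "h \<in> H" for h
    using assms that unfolding max_matching_def by blast
  show "h \<in> H \<Longrightarrow> card h = 3" by (rule c)
  show "h \<in> H \<Longrightarrow> finite h" using c card.infinite by fastforce
  show "h \<in> H \<Longrightarrow> h \<noteq> {}" using c by fastforce
  show "finite M" using assms unfolding max_matching_def by (meson finite_subset)
qed (use assms[unfolded max_matching_def] in blast)+

text \<open>Send each member of \<open>M\<close> that meets \<open>U\<close> to an element of
  \<open>U\<close> inside it; by disjointness no element serves two members.\<close>

lemma card_roots_le:
  assumes "disjoint M" "finite U"
  shows "card {h \<in> M. h \<inter> U \<noteq> {}} \<le> card U"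
proof -
  define g where "g h = (SOME u. u \<in> h \<inter> U)" for h
  have g: "g h \<in> h \<inter> U" if "h \<inter> U \<noteq> {}" for h
    unfolding g_def using that by (metis some_in_eq)
  have "inj_on g {h \<in> M. h \<inter> U \<noteq> {}}"
  proof (rule inj_onI)
    fix h h' assume *: "h \<in> {h \<in> M. h \<inter> U \<noteq> {}}" "h' \<in> {h \<in> M. h \<inter> U \<noteq> {}}" "g h = g h'"
    then have "g h \<in> h" "g h \<in> h'" using g[of h] g[of h'] by simp_all
    then show "h = h'" using disjoint_eqI[OF assms(1)] * by simp
  qed
  then show ?thesis
    by (rule card_inj_on_le) (use g assms(2) in auto)
qed

text \<open>Freeing all of \<open>f\<close> without shrinking the matching would leave room to add
  \<open>f\<close>, against maximality. The three elements of \<open>f\<close> meet at most three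
  members of \<open>M\<close>, which explains the parameters 3 and 3.\<close>

lemma switchable_no_edge:
  assumes M: "max_matching H M" and S: "switchable H M F 3 3 s" and f: "f \<in> H" "f \<subseteq> F"
  shows False
proof -
  note m = max_matchingD[OF M]
  have c: "card f = 3" "finite f" "f \<noteq> {}" using m(2-4) f(1) by auto
  have r: "card {h \<in> M. h \<inter> f \<noteq> {}} \<le> 3"
    using card_roots_le[OF m(6) c(2)] c(1) by simp
  obtain N where N: "N \<subseteq> H" "disjoint N" "card N = card M" "({} \<union> f) \<inter> \<Union>N = {}"
    using S[unfolded switchable_def, rule_format, of M "{}" "{}" f] m(5,6) f(2) c r by auto
  have "finite N" by (rule finite_subset[OF N(1) m(1)])
  moreover have "f \<notin> N" using N(4) c(3) by blast
  ultimately have "card (insert f N) = Suc (card M)" using N(3) by simp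
  moreover have "card (insert f N) \<le> card M"
    using N f(1) by (intro m(8) disjoint_insertI) auto
  ultimately show False by simp
qed

text \<open>Two robust elements of one edge \<open>h\<close> would allow \<open>h\<close> to be
  traded for two disjoint edges, one through each of them, and the matching would grow.\<close>

lemma switchable_robust_unique:
  assumes M: "max_matching H M" and S: "switchable H M F 4 4 s" and b: "6 \<le> b"
    and h: "h \<in> M" and x: "x \<in> h" "robust H b F x" and y: "y \<in> h" "robust H b F y"
  shows "x = y"
proof (rule ccontr)
  assume xy: "x \<noteq> y"
  note m = max_matchingD[OF M]
  have hH: "h \<in> H" using h m(5) by auto
  have ch: "card h = 3" "finite h" using m(2,3) hH by auto
  have "card h \<le> b" using ch b by simp
  then obtain f where f: "f \<in> H" "x \<in> f" "f - {x} \<subseteq> F" "(f - {x}) \<inter> h = {}"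
    using robustD[OF x(2) ch(2)] by blast
  have cf: "card f = 3" "finite f" using m(2,3) f(1) by auto
  \<comment> \<open>The second edge must avoid the first one as well; the set to avoid has at most 6
    elements, whence \<open>6 \<le> b\<close>.\<close>
  have "card (h \<union> f) \<le> b" using card_Un_le[of h f] ch cf b by linarith
  then obtain g where g: "g \<in> H" "y \<in> g" "g - {y} \<subseteq> F" "(g - {y}) \<inter> (h \<union> f) = {}"
    using robustD[OF y(2), of "h \<union> f"] ch(2) cf(2) by blast
  have cg: "card g = 3" "finite g" using m(2,3) g(1) by auto
  \<comment> \<open>These elements are freed while \<open>h\<close> is kept; removing
    \<open>h\<close> afterwards makes room at \<open>x\<close> and \<open>y\<close>.\<close>
  define U where "U = (f - {x}) \<union> (g - {y})"
  have U: "finite U" "U \<subseteq> F" "U \<inter> h = {}" using f g cf cg unfolding U_def by auto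
  have cU: "card U \<le> 4"
    using card_Un_le[of "f - {x}" "g - {y}"] cf cg f(2) g(2) unfolding U_def by simp
  have r: "card {h \<in> M. h \<inter> U \<noteq> {}} \<le> 4"
    using card_roots_le[OF m(6) U(1)] cU by linarith
  obtain N where N: "N \<subseteq> H" "disjoint N" "card N = card M" "h \<in> N" "({} \<union> U) \<inter> \<Union>N = {}"
    using S[unfolded switchable_def, rule_format, of M "{h}" "{}" U] m(5,6) U cU r h by auto
  have finN: "finite N" by (rule finite_subset[OF N(1) m(1)])
  have fN: "f \<inter> \<Union>(N - {h}) = {}"
    using N(5) disjoint_eqI[OF N(2) N(4) _ x(1)] unfolding U_def by blast
  have gf: "g \<inter> f = {}"
    using g(2,4) f(2,4) x(1) y(1) xy by blast
  have gN: "g \<inter> \<Union>(insert f (N - {h})) = {}"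
    using gf N(5) disjoint_eqI[OF N(2) N(4) _ y(1)] unfolding U_def by blast
  have dis: "disjoint (insert g (insert f (N - {h})))"
    using N(2) fN gN by (intro disjoint_insertI) (auto simp: disjoint_def)
  have "card (insert g (insert f (N - {h}))) = Suc (Suc (card (N - {h})))"
  proof -
    have "f \<notin> N - {h}" using fN f(2) by blast
    moreover have "g \<notin> insert f (N - {h})" using gN g(2) by blast
    ultimately show ?thesis using finN by simp
  qed
  also have "\<dots> = Suc (card M)" using card_Suc_Diff1[OF finN N(4)] N(3) by simp
  finally show False using m(8)[OF _ dis] N(1) f(1) g(1) by auto
qed

text \<open>The only element of \<open>f\<close> that \<open>N\<close> covers is \<open>x\<close>,
  and \<open>h\<close> is what covers it. So \<open>f\<close> fits once \<open>h\<close> is removed,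
  and the rest of \<open>h\<close> becomes uncovered unless it lies in \<open>f\<close>.\<close>

lemma swap_edge:
  assumes N: "disjoint N" "finite N" "h \<in> N" and x: "x \<in> h" "x \<in> f" and f: "(f - {x}) \<inter> \<Union>N = {}"
  shows "disjoint (insert f (N - {h}))" "card (insert f (N - {h})) = card N"
    "\<Union>(insert f (N - {h})) = (\<Union>N - h) \<union> f"
proof -
  have fN: "f \<inter> \<Union>(N - {h}) = {}"
    using f disjoint_eqI[OF N(1) N(3) _ x(1)] by blast
  show "disjoint (insert f (N - {h}))"
    using N(1) fN by (intro disjoint_insertI) (auto simp: disjoint_def)
  have "f \<notin> N - {h}" using fN x(2) by blast
  then show "card (insert f (N - {h})) = card N"
    using card_Suc_Diff1[OF N(2,3)] N(2) by simp
  have "\<Union>(N - {h}) = \<Union>N - h"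
  proof (intro equalityI subsetI)
    fix y assume "y \<in> \<Union>(N - {h})"
    then obtain g where "g \<in> N" "g \<noteq> h" "y \<in> g" by blast
    then show "y \<in> \<Union>N - h" using disjoint_eqI[OF N(1) _ N(3), of g y] by blast
  qed blast
  then show "\<Union>(insert f (N - {h})) = (\<Union>N - h) \<union> f" by blast
qed

lemma card_diff_swap:
  assumes "finite N" "finite M" "card N = card M"
  shows "card (M - N) = card (N - M)"
  using assms by (simp add: card_Diff_subset_Int Int_commute)

lemma card_Union_le_3:
  assumes "finite K" "\<And>h. h \<in> K \<Longrightarrow> card h = 3"
  shows "card (\<Union>K) \<le> 3 * card K"
proof -
  have "card (\<Union>K) \<le> sum card K" by (rule card_Union_le_sum_card)
  also have "\<dots> = 3 * card K" using assms(2) by simp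
  finally show ?thesis .
qed

lemma Int_Union_eq_empty_if_no_roots:
  assumes "{h \<in> M. h \<inter> U \<noteq> {}} = {}" "U \<inter> \<Union>(N - M) = {}"
  shows "U \<inter> \<Union>N = {}"
proof -
  have False if "u \<in> U" "h \<in> N" "u \<in> h" for u h
    using assms that by (cases "h \<in> M") auto
  then show ?thesis by blast
qed

text \<open>If no edge of \<open>M\<close> meets \<open>U\<close>, then \<open>U\<close> is
  uncovered already and \<open>N\<close> itself serves.\<close>

lemma switchable_roots_0:
  assumes M: "max_matching H M"
  shows "switchable H M F 0 t t"
  unfolding switchable_def
proof (intro allI impI)
  fix N K A U
  assume N: "N \<subseteq> H" "disjoint N" "card N = card M" "card (N - M) \<le> t" "K \<subseteq> N"
    "A \<inter> \<Union>N = {}" "U \<inter> \<Union>(N - M) = {}" and r: "card {h \<in> M. h \<inter> U \<noteq> {}} \<le> 0"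
  have "{h \<in> M. h \<inter> U \<noteq> {}} = {}" using r max_matchingD(7)[OF M] by simp
  then have "U \<inter> \<Union>N = {}" using N(7) by (rule Int_Union_eq_empty_if_no_roots)
  then have "(A \<union> U) \<inter> \<Union>N = {}" using N(6) by blast
  then show "\<exists>N'. N' \<subseteq> H \<and> disjoint N' \<and> card N' = card M \<and> card (N' - M) \<le> t \<and>
           K \<subseteq> N' \<and> (A \<union> U) \<inter> \<Union>N' = {}"
    using N by blast
qed

text \<open>Call the edges of \<open>M\<close> meeting \<open>U\<close> its roots. For one root
  \<open>h\<close>, an edge \<open>f\<close> through the pivot of \<open>h\<close> is cleared at
  level \<open>i\<close>, and \<open>h\<close> is swapped for \<open>f\<close>, which uncovers the
  part of \<open>U\<close> in \<open>h\<close>. The at most \<open>r\<close> remaining roots are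
  left to \<open>S2\<close>, with budgets enlarged by the changes made so far.\<close>

lemma switchable_step:
  assumes M: "max_matching H M"
    and S4: "switchable H M (freeable H W M b i) 4 4 s0"
    and S1: "switchable H M (freeable H W M b i) 2 (2 * t + r + 3) s1"
    and S2: "switchable H M (freeable H W M b (Suc i)) r (2 * t + s1 + 1) s2"
    and b: "6 \<le> b" "11 * t + 3 * r + 3 \<le> b"
  shows "switchable H M (freeable H W M b (Suc i)) (Suc r) t (max t s2)"
  unfolding switchable_def
proof (intro allI impI)
  fix N K A U
  assume N: "N \<subseteq> H" "disjoint N" "card N = card M" "card (N - M) \<le> t"
    and K: "K \<subseteq> N" "card K \<le> t" and A: "finite A" "card A \<le> t" "A \<inter> \<Union>N = {}"
    and U: "finite U" "card U \<le> t" "U \<subseteq> freeable H W M b (Suc i)"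
    and UN: "U \<inter> \<Union>(N - M) = {}" "U \<inter> \<Union>(M - N) = {}" "U \<inter> \<Union>K = {}"
    and r: "card {h \<in> M. h \<inter> U \<noteq> {}} \<le> Suc r"
  note m = max_matchingD[OF M]
  define Q where "Q = {h \<in> M. h \<inter> U \<noteq> {}}"
  have finN: "finite N" using N(1) m(1) finite_subset by blast
  have QM: "Q \<subseteq> M" unfolding Q_def by blast
  have "Q \<subseteq> N"
  proof
    fix h assume "h \<in> Q"
    then obtain u where "h \<in> M" "u \<in> h" "u \<in> U" unfolding Q_def by blast
    then show "h \<in> N" using UN(2) by blast
  qed
  then have QN: "Q \<subseteq> N" "Q \<subseteq> M" "finite Q"
    using QM finite_subset[OF QM m(7)] by simp_all
  show "\<exists>N'. N' \<subseteq> H \<and> disjoint N' \<and> card N' = card M \<and> card (N' - M) \<le> max t s2 \<and>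
           K \<subseteq> N' \<and> (A \<union> U) \<inter> \<Union>N' = {}"
  proof (cases "Q = {}")
    case True
    then have "U \<inter> \<Union>N = {}"
      using UN(1) unfolding Q_def by (rule Int_Union_eq_empty_if_no_roots)
    then have "(A \<union> U) \<inter> \<Union>N = {}" using A(3) by blast
    moreover have "card (N - M) \<le> max t s2" using N(4) by simp
    ultimately show ?thesis using N(1-3) K(1) by blast
  next
    case False
    then obtain h where hQ: "h \<in> Q" by blast
    then have h: "h \<in> M" "h \<in> N" "h \<inter> U \<noteq> {}" using QN unfolding Q_def by auto
    \<comment> \<open>By disjointness of \<open>M\<close> the edge that makes \<open>u\<close>
      freeable is \<open>h\<close> itself, and its pivot differs from \<open>u\<close>.\<close>
    have pivot: "\<exists>x \<in> h \<inter> W. robust H b (freeable H W M b i) x \<and> u \<noteq> x" if u: "u \<in> h \<inter> U" for u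
    proof -
      have "u \<in> \<Union>M" using u h(1) by blast
      then obtain h' x where h': "h' \<in> M" "x \<in> h' \<inter> W" "robust H b (freeable H W M b i) x" "u \<in> h' - {x}"
        using u U(3) by auto
      then have "h' = h" using disjoint_eqI[OF m(6) h'(1) h(1), of u] u by blast
      then show ?thesis using h' by blast
    qed
    obtain x where x: "x \<in> h" "robust H b (freeable H W M b i) x"
      using pivot h(3) by blast
    \<comment> \<open>If \<open>x\<close> were in \<open>U\<close>, it would have a pivot other than
      itself, but \<open>h\<close> has only one robust element. Hence putting \<open>f\<close>
      through \<open>x\<close> does not cover \<open>U\<close> again.\<close>
    have xU: "x \<notin> U"
      using pivot[of x] switchable_robust_unique[OF M S4 b(1) h(1) x] x(1) by blast
    \<comment> \<open>Everything involved so far, to be avoided by \<open>f\<close> outside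
      \<open>x\<close>. The sets \<open>A\<close> and \<open>U\<close> contribute
      \<open>2 * t\<close> and the edges \<open>3 * (3 * t + r + 1)\<close>, which add up to the
      bound required of \<open>b\<close>.\<close>
    define B where "B = A \<union> U \<union> \<Union>(K \<union> Q \<union> (N - M) \<union> (M - N))"
    have sub: "K \<union> Q \<union> (N - M) \<union> (M - N) \<subseteq> H" using K(1) N(1) QN m(5) by blast
    have "card B \<le> card A + card U + card (\<Union>(K \<union> Q \<union> (N - M) \<union> (M - N)))"
      unfolding B_def using card_Un_le[of "A \<union> U"] card_Un_le[of A U] by (meson add_le_mono1 le_trans)
    also have "card (\<Union>(K \<union> Q \<union> (N - M) \<union> (M - N))) \<le> 3 * card (K \<union> Q \<union> (N - M) \<union> (M - N))"
      using sub m(2) by (intro card_Union_le_3 finite_subset[OF sub m(1)]) blast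
    also have "card (K \<union> Q \<union> (N - M) \<union> (M - N)) \<le> card K + card Q + card (N - M) + card (M - N)"
      by (meson add_le_mono1 card_Un_le le_trans)
    also have "card (M - N) = card (N - M)" by (rule card_diff_swap[OF finN m(7) N(3)])
    finally have cB: "card B \<le> b"
      using A(2) U(2) K(2) N(4) r b(2) unfolding Q_def by simp
    have "finite (\<Union>(K \<union> Q \<union> (N - M) \<union> (M - N)))"
      using sub m(3) by (intro finite_Union finite_subset[OF sub m(1)]) blast
    then have "finite B" unfolding B_def using A(1) U(1) by blast
    then obtain f where f: "f \<in> H" "x \<in> f" "f - {x} \<subseteq> freeable H W M b i" "(f - {x}) \<inter> B = {}"
      using robustD[OF x(2) _ cB] by blast
    have cf: "finite f" "card (f - {x}) = 2" using m(2,3)[OF f(1)] f(2) by auto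
    have rf: "card {h \<in> M. h \<inter> (f - {x}) \<noteq> {}} \<le> 2"
      using card_roots_le[OF m(6), of "f - {x}"] cf by simp
    have cK1: "card (K \<union> Q) \<le> 2 * t + r + 3"
      using card_Un_le[of K Q] K(2) r unfolding Q_def by linarith
    have cA1: "card (A \<union> (U - \<Union>M)) \<le> 2 * t + r + 3"
      using card_Un_le[of A "U - \<Union>M"] A(2) card_mono[OF U(1), of "U - \<Union>M"] U(2) by auto
    have A1: "(A \<union> (U - \<Union>M)) \<inter> \<Union>N = {}" using A(3) UN(1) by blast
    have fB: "(f - {x}) \<inter> \<Union>(N - M) = {}" "(f - {x}) \<inter> \<Union>(M - N) = {}"
        "(f - {x}) \<inter> \<Union>(K \<union> Q) = {}"
      using f(4) unfolding B_def by blast+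
    \<comment> \<open>All roots are kept along with \<open>K\<close>: \<open>h\<close> must still be
      present for the swap, and the others must be untouched when \<open>S2\<close> is
      applied.\<close>
    have "\<exists>N1. N1 \<subseteq> H \<and> disjoint N1 \<and> card N1 = card M \<and> card (N1 - M) \<le> s1 \<and>
        K \<union> Q \<subseteq> N1 \<and> (A \<union> (U - \<Union>M) \<union> (f - {x})) \<inter> \<Union>N1 = {}"
      by (rule switchableD[OF S1 N(1-3)]) (use N(4) K(1) QN(1) cK1 A(1) U(1) cA1 A1 cf rf f(3) fB in simp_all)
    then obtain N1 where N1: "N1 \<subseteq> H" "disjoint N1" "card N1 = card M" "card (N1 - M) \<le> s1"
        "K \<union> Q \<subseteq> N1" "(A \<union> (U - \<Union>M) \<union> (f - {x})) \<inter> \<Union>N1 = {}"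
      by blast
    have finN1: "finite N1" using N1(1) m(1) finite_subset by blast
    have hN1: "h \<in> N1" using N1(5) hQ by blast
    have fN1: "(f - {x}) \<inter> \<Union>N1 = {}" using N1(6) by blast
    define N2 where "N2 = insert f (N1 - {h})"
    note sw = swap_edge[OF N1(2) finN1 hN1 x(1) f(2) fN1, folded N2_def]
    define P where "P = Q - {h}"
    have "card (N2 - M) \<le> card (insert f (N1 - M))"
      unfolding N2_def using finN1 by (intro card_mono) auto
    also have "\<dots> \<le> s1 + 1" using N1(4) by (simp add: card_insert_if finN1)
    finally have cN2: "card (N2 - M) \<le> 2 * t + s1 + 1" by linarith
    have hK: "h \<notin> K" using h(3) UN(3) by blast
    then have KN2: "K \<subseteq> N2" "P \<subseteq> N2" using N1(5) unfolding N2_def P_def by auto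
    have fA: "f \<inter> A = {}"
    proof -
      have "x \<notin> A" using A(3) x(1) h(2) by blast
      then show ?thesis using f(4) unfolding B_def by blast
    qed
    have fU: "f \<inter> U = {}" using f(4) xU unfolding B_def by blast
    have A2: "(A \<union> (U - \<Union>P)) \<inter> \<Union>N2 = {}"
    proof -
      have "U - \<Union>P \<subseteq> (U - \<Union>M) \<union> (U \<inter> h)" unfolding P_def Q_def by blast
      then show ?thesis using fA fU N1(6) unfolding sw(3) by blast
    qed
    have cA2: "card (A \<union> (U - \<Union>P)) \<le> 2 * t + s1 + 1"
      using card_Un_le[of A "U - \<Union>P"] A(2) card_mono[OF U(1), of "U - \<Union>P"] U(2) by auto
    have cU2: "card (U \<inter> \<Union>P) \<le> 2 * t + s1 + 1"
      using card_mono[OF U(1), of "U \<inter> \<Union>P"] U(2) by auto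
    have PM: "P \<subseteq> M" using QN(2) unfolding P_def by blast
    have i1: "U \<inter> \<Union>P \<inter> \<Union>(N2 - M) = {}"
      using KN2(2) PM disjoint_eqI[OF sw(1)] by blast
    have i2: "U \<inter> \<Union>P \<inter> \<Union>(M - N2) = {}"
      using KN2(2) PM disjoint_eqI[OF m(6)] by blast
    have i3: "U \<inter> \<Union>P \<inter> \<Union>K = {}" using UN(3) by blast
    have "{g \<in> M. g \<inter> (U \<inter> \<Union>P) \<noteq> {}} \<subseteq> P"
      using PM disjoint_eqI[OF m(6)] by blast
    then have "card {g \<in> M. g \<inter> (U \<inter> \<Union>P) \<noteq> {}} \<le> card P"
      using QN(3) unfolding P_def by (intro card_mono) auto
    also have "card P \<le> r" using hQ QN(3) r unfolding P_def Q_def[symmetric] by simp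
    finally have cr: "card {g \<in> M. g \<inter> (U \<inter> \<Union>P) \<noteq> {}} \<le> r" .
    \<comment> \<open>The part of \<open>U\<close> outside the remaining roots \<open>P\<close> is
      uncovered by now, so it joins \<open>A\<close>; only the part inside \<open>P\<close> is still
      to be freed.\<close>
    have "\<exists>N3. N3 \<subseteq> H \<and> disjoint N3 \<and> card N3 = card M \<and> card (N3 - M) \<le> s2 \<and>
        K \<subseteq> N3 \<and> (A \<union> (U - \<Union>P) \<union> (U \<inter> \<Union>P)) \<inter> \<Union>N3 = {}"
    proof (rule switchableD[OF S2 _ sw(1) _ cN2 KN2(1)])
      show "N2 \<subseteq> H" using N1(1) f(1) unfolding N2_def by blast
      show "card N2 = card M" using sw(2) N1(3) by simp
      show "card K \<le> 2 * t + s1 + 1" using K(2) by simp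
      show "U \<inter> \<Union>P \<subseteq> freeable H W M b (Suc i)" using U(3) by blast
      show "finite (A \<union> (U - \<Union>P))" "finite (U \<inter> \<Union>P)" using A(1) U(1) by simp_all
    qed (rule cA2 A2 cU2 i1 i2 i3 cr)+
    then obtain N3 where N3: "N3 \<subseteq> H" "disjoint N3" "card N3 = card M" "card (N3 - M) \<le> s2"
        "K \<subseteq> N3" "(A \<union> (U - \<Union>P) \<union> (U \<inter> \<Union>P)) \<inter> \<Union>N3 = {}"
      by blast
    have "(A \<union> U) \<inter> \<Union>N3 = {}" using N3(6) by blast
    then show ?thesis using N3 by (intro exI[of _ N3]) auto
  qed
qed

text \<open>Outer induction on \<open>i\<close>, inner induction on the number \<open>r\<close> of
  roots, with \<open>t\<close> arbitrary because every exchange enlarges the budgets. The constants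
  are chosen before \<open>H\<close>, \<open>M\<close> and \<open>b\<close>, so a single
  \<open>b\<close> can later serve all graphs.\<close>

lemma freeable_switchable:
  fixes W :: "'a set"
  shows "\<exists>s b\<^sub>0. \<forall>(H :: 'a set set) M b. max_matching H M \<longrightarrow> b\<^sub>0 \<le> b \<longrightarrow>
     switchable H M (freeable H W M b i) r t s"
proof (induction i arbitrary: r t)
  case 0
  have "switchable H M (freeable H W M b 0) r t t" if M: "max_matching H M" for H :: "'a set set" and M b
    unfolding switchable_def
  proof (intro allI impI)
    fix N K A U
    assume "N \<subseteq> H" "disjoint N" "card N = card M" "card (N - M) \<le> t" "K \<subseteq> N"
       "A \<inter> \<Union>N = {}" "U \<inter> \<Union>(N - M) = {}" "U \<subseteq> freeable H W M b 0"
    moreover from this have "(A \<union> U) \<inter> \<Union>N = {}" unfolding freeable.simps by blast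
    ultimately show "\<exists>N'. N' \<subseteq> H \<and> disjoint N' \<and> card N' = card M \<and> card (N' - M) \<le> t \<and>
           K \<subseteq> N' \<and> (A \<union> U) \<inter> \<Union>N' = {}"
      by blast
  qed
  then show ?case by blast
next
  case (Suc i)
  note IH = Suc.IH
  show ?case
  proof (induction r arbitrary: t)
    case 0
    show ?case using switchable_roots_0 by blast
  next
    case (Suc r)
    obtain s0 b0 where S0: "\<And>H M b. max_matching H M \<Longrightarrow> b0 \<le> b \<Longrightarrow>
        switchable H M (freeable H W M b i) 4 4 s0"
      using IH[of 4 4] by blast
    obtain s1 b1 where S1: "\<And>H M b. max_matching H M \<Longrightarrow> b1 \<le> b \<Longrightarrow>
        switchable H M (freeable H W M b i) 2 (2 * t + r + 3) s1"
      using IH[of 2 "2 * t + r + 3"] by blast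
    \<comment> \<open>The constant \<open>s1\<close> has to be known first: after the swap the
      matching may differ from \<open>M\<close> in \<open>s1 + 1\<close> edges.\<close>
    obtain s2 b2 where S2: "\<And>H M b. max_matching H M \<Longrightarrow> b2 \<le> b \<Longrightarrow>
        switchable H M (freeable H W M b (Suc i)) r (2 * t + s1 + 1) s2"
      using Suc.IH[of "2 * t + s1 + 1"] by blast
    have "switchable H M (freeable H W M b (Suc i)) (Suc r) t (max t s2)"
      if "max_matching H M" "b0 + b1 + b2 + 6 + (11 * t + 3 * r + 3) \<le> b" for H M b
      using that by (intro switchable_step[OF _ S0 S1 S2]) auto
    then show ?case by blast
  qed
qed

section \<open>Existence of maximum matchings\<close>

lemma ex_max_disjoint:
  assumes "finite H"
  obtains M where "M \<subseteq> H" "disjoint M" "\<And>N. N \<subseteq> H \<Longrightarrow> disjoint N \<Longrightarrow> card N \<le> card M"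
proof -
  define S where "S = {N. N \<subseteq> H \<and> disjoint N}"
  have S: "finite S" "{} \<in> S" unfolding S_def using assms by auto
  have "finite (card ` S)" "card ` S \<noteq> {}" using S by auto
  then have "Max (card ` S) \<in> card ` S" by (rule Max_in)
  then obtain M where M: "M \<in> S" "card M = Max (card ` S)" by auto
  have "card N \<le> card M" if "N \<in> S" for N
    using M(2) S(1) that by simp
  then show thesis using M(1) that[of M] unfolding S_def by blast
qed

lemma ex_max_matching:
  assumes "finite H" "\<And>h. h \<in> H \<Longrightarrow> card h = 3"
  obtains M where "max_matching H M"
  using ex_max_disjoint[OF assms(1)] assms unfolding max_matching_def by metis

subsection \<open>Missing few colours\<close>

text \<open>Matchings in this 3-uniform hypergraph are the rainbow matchings of the coloured graph.\<close>

definition triples :: "'c set \<Rightarrow> ('c \<Rightarrow> 'v \<Rightarrow> 'v \<Rightarrow> bool) \<Rightarrow> ('v + 'c) set set" where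
  "triples C adj = {{Inl u, Inl v, Inr c} | u v c. c \<in> C \<and> adj c u v}"

text \<open>Symmetry, irreflexivity and transitivity for distinct ends say that every component of a
  colour is a clique. Parallel edges appear as one pair that is adjacent in several colours.\<close>

locale clique_colouring =
  fixes V :: "'v set" and C :: "'c set" and adj :: "'c \<Rightarrow> 'v \<Rightarrow> 'v \<Rightarrow> bool"
  assumes finite_V: "finite V" and finite_C: "finite C"
    and adj_in_V: "adj c u v \<Longrightarrow> u \<in> V"
    and adj_sym: "adj c u v \<Longrightarrow> adj c v u"
    and adj_irrefl: "\<not> adj c u u"
    and adj_trans: "adj c u v \<Longrightarrow> adj c v w \<Longrightarrow> u \<noteq> w \<Longrightarrow> adj c u w"
begin

lemma adj_in_V2: "adj c u v \<Longrightarrow> v \<in> V"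
  using adj_in_V adj_sym by blast

definition span :: "'c \<Rightarrow> 'v set" where
  "span c = {v. \<exists>u. adj c u v}"

lemma span_subset: "span c \<subseteq> V"
  unfolding span_def using adj_in_V adj_sym by blast

lemma finite_span: "finite (span c)"
  using span_subset finite_V by (rule finite_subset)

lemma triplesI: "c \<in> C \<Longrightarrow> adj c u v \<Longrightarrow> {Inl u, Inl v, Inr c} \<in> triples C adj"
  unfolding triples_def by blast

lemma triplesE:
  assumes "h \<in> triples C adj"
  obtains u v c where "h = {Inl u, Inl v, Inr c}" "c \<in> C" "adj c u v" "u \<noteq> v"
  using assms adj_irrefl unfolding triples_def by blast

lemma finite_triples: "finite (triples C adj)"
proof -
  have "triples C adj \<subseteq> (\<lambda>(u, v, c). {Inl u, Inl v, Inr c}) ` (V \<times> V \<times> C)"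
  proof
    fix h assume "h \<in> triples C adj"
    then obtain u v c where "h = {Inl u, Inl v, Inr c}" "c \<in> C" "adj c u v" by (rule triplesE)
    then show "h \<in> (\<lambda>(u, v, c). {Inl u, Inl v, Inr c}) ` (V \<times> V \<times> C)"
      using adj_in_V adj_in_V2 by (intro image_eqI[of _ _ "(u, v, c)"]) auto
  qed
  then show ?thesis by (rule finite_subset) (simp add: finite_V finite_C)
qed

lemma card_triple:
  assumes "h \<in> triples C adj" shows "card h = 3"
  using assms by (elim triplesE) simp

end

section \<open>Counting vertices and colours relative to a maximum matching\<close>

locale maximum_colouring_matching = clique_colouring +
  fixes M :: "('a + 'b) set set" and b :: nat
  assumes max: "max_matching (triples C adj) M"
begin

abbreviation free :: "nat \<Rightarrow> ('a + 'b) set" where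
  "free i \<equiv> freeable (triples C adj) (range Inl) M b i"

definition covered :: "'a set" where
  "covered = {v. Inl v \<in> \<Union>M}"

definition free_verts :: "nat \<Rightarrow> 'a set" where
  "free_verts i = {v \<in> V. Inl v \<in> free i}"

definition free_colours :: "nat \<Rightarrow> 'b set" where
  "free_colours i = {c \<in> C. Inr c \<in> free i}"

text \<open>The index is shifted to match \<open>freeable\<close>: robustness with respect to level
  \<open>i\<close> produces the freed elements of level \<open>Suc i\<close>, and at level 0 nothing
  has been exchanged.\<close>

fun pivots :: "nat \<Rightarrow> 'a set" where
  "pivots 0 = {}"
| "pivots (Suc i) = {v \<in> covered. robust (triples C adj) b (free i) (Inl v)}"

lemma finite_M: "finite M" and M_triples: "M \<subseteq> triples C adj" and M_disjoint: "disjoint M"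
  using max_matchingD[OF max] by blast+

lemma uncovered_free: "x \<notin> \<Union>M \<Longrightarrow> x \<in> free i"
  by (cases i) auto

lemma M_E:
  assumes "h \<in> M"
  obtains u v c where "h = {Inl u, Inl v, Inr c}" "c \<in> C" "adj c u v" "u \<noteq> v"
  using triplesE[OF subsetD[OF M_triples assms]] .

text \<open>Every edge of \<open>M\<close> contains exactly one colour, and disjoint edges contain
  different ones.\<close>

lemma card_covered_colours: "card {c \<in> C. Inr c \<in> \<Union>M} = card M"
proof (rule antisym)
  have "\<exists>c. c \<in> C \<and> Inr c \<in> h" if "h \<in> M" for h
    using M_E[OF that] by (metis insertCI)
  then obtain g where g: "\<And>h. h \<in> M \<Longrightarrow> g h \<in> C \<and> Inr (g h) \<in> h" by metis
  have "inj_on g M"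
  proof (rule inj_onI)
    fix h h' assume "h \<in> M" "h' \<in> M" "g h = g h'"
    then show "h = h'" using disjoint_eqI[OF M_disjoint, of h h' "Inr (g h)"] g by metis
  qed
  then show "card M \<le> card {c \<in> C. Inr c \<in> \<Union>M}"
    using g finite_C by (intro card_inj_on_le[of g]) auto
next
  have "{c \<in> C. Inr c \<in> \<Union>M} \<subseteq> (\<Union>h\<in>M. {c \<in> C. Inr c \<in> h})" by blast
  then have "card {c \<in> C. Inr c \<in> \<Union>M} \<le> card (\<Union>h\<in>M. {c \<in> C. Inr c \<in> h})"
    using finite_C finite_M by (intro card_mono) auto
  also have "\<dots> \<le> (\<Sum>h\<in>M. card {c \<in> C. Inr c \<in> h})" by (rule card_UN_le[OF finite_M])
  also have "\<dots> \<le> (\<Sum>h\<in>M. 1)"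
  proof (rule sum_mono)
    fix h assume h: "h \<in> M"
    obtain u v c where "h = {Inl u, Inl v, Inr c}"
      using M_E[OF h] by metis
    then have "{c \<in> C. Inr c \<in> h} \<subseteq> {c}" by auto
    then show "card {c \<in> C. Inr c \<in> h} \<le> 1" using card_mono[of "{c}"] by simp
  qed
  finally show "card {c \<in> C. Inr c \<in> \<Union>M} \<le> card M" by simp
qed

lemma card_M_le: "card M \<le> card C"
  using card_mono[OF finite_C, of "{c \<in> C. Inr c \<in> \<Union>M}"] card_covered_colours by auto

lemma card_missing: "card {c \<in> C. Inr c \<notin> \<Union>M} = card C - card M"
proof -
  have "{c \<in> C. Inr c \<notin> \<Union>M} = C - {c \<in> C. Inr c \<in> \<Union>M}" by blast
  then show ?thesis using finite_C card_covered_colours by (simp add: card_Diff_subset)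
qed

lemma covered_subset: "covered \<subseteq> V"
proof
  fix x assume "x \<in> covered"
  then obtain h where h: "h \<in> M" "Inl x \<in> h" unfolding covered_def by blast
  then obtain u v c where "h = {Inl u, Inl v, Inr c}" "adj c u v"
    using M_E[OF h(1)] by metis
  then show "x \<in> V" using h(2) adj_in_V adj_in_V2 by auto
qed

lemma finite_covered: "finite covered"
  using covered_subset finite_V by (rule finite_subset)

lemma card_covered_le: "card covered \<le> 2 * card M"
proof -
  have "covered \<subseteq> (\<Union>h\<in>M. {v \<in> V. Inl v \<in> h})"
    using covered_subset unfolding covered_def by blast
  then have "card covered \<le> card (\<Union>h\<in>M. {v \<in> V. Inl v \<in> h})"
    using finite_V finite_M by (intro card_mono) auto
  also have "\<dots> \<le> (\<Sum>h\<in>M. card {v \<in> V. Inl v \<in> h})" by (rule card_UN_le[OF finite_M])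
  also have "\<dots> \<le> (\<Sum>h\<in>M. 2)"
  proof (rule sum_mono)
    fix h assume h: "h \<in> M"
    obtain u v c where "h = {Inl u, Inl v, Inr c}" "u \<noteq> v"
      using M_E[OF h] by metis
    then have "{v \<in> V. Inl v \<in> h} \<subseteq> {u, v}" "card {u, v} = 2" by auto
    then show "card {v \<in> V. Inl v \<in> h} \<le> 2" using card_mono[of "{u, v}"] by fastforce
  qed
  finally show ?thesis by simp
qed

lemma pivots_subset: "pivots i \<subseteq> covered"
  by (cases i) auto

text \<open>Exchanging a pivot frees the other vertex of its edge of \<open>M\<close>. This vertex
  determines the edge, hence the pivot, because an edge has only two vertices.\<close>

lemma card_pivots_le: "card (pivots i) \<le> card (covered \<inter> free_verts i)"
proof (cases i)
  case (Suc j)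
  have ex: "\<exists>y h. h \<in> M \<and> Inl x \<in> h \<and> Inl y \<in> h \<and> y \<noteq> x" if x: "x \<in> pivots i" for x
  proof -
    obtain h where h: "h \<in> M" "Inl x \<in> h"
      using x pivots_subset unfolding covered_def by blast
    obtain u v c where "h = {Inl u, Inl v, Inr c}" "u \<noteq> v"
      using M_E[OF h(1)] by metis
    then show ?thesis using h by (cases "x = u") auto
  qed
  then obtain g e where g: "\<And>x. x \<in> pivots i \<Longrightarrow> e x \<in> M \<and> Inl x \<in> e x \<and> Inl (g x) \<in> e x \<and> g x \<noteq> x"
    by metis
  have "inj_on g (pivots i)"
  proof (rule inj_onI)
    fix x x' assume x: "x \<in> pivots i" "x' \<in> pivots i" "g x = g x'"
    have eq: "e x = e x'"
      using disjoint_eqI[OF M_disjoint, of "e x" "e x'" "Inl (g x)"] g[OF x(1)] g[OF x(2)] x(3) by simp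
    obtain u v c where "e x = {Inl u, Inl v, Inr c}" "u \<noteq> v"
      using g[OF x(1)] M_E[of "e x"] by metis
    then show "x = x'" using g[OF x(1)] g[OF x(2)] x(3) eq by auto
  qed
  moreover have "g x \<in> covered \<inter> free_verts i" if x: "x \<in> pivots i" for x
  proof -
    have "g x \<in> covered" using g[OF x] unfolding covered_def by blast
    moreover have "Inl (g x) \<in> free i"
      using g[OF x] x Suc by auto
    ultimately show ?thesis using covered_subset unfolding free_verts_def by blast
  qed
  ultimately show ?thesis using finite_covered by (intro card_inj_on_le[of g]) auto
qed simp

text \<open>A vertex that is not free is covered. Of the at most \<open>2 * card M\<close> covered
  vertices, at least \<open>card (pivots i)\<close> are free.\<close>

lemma card_span_free_ge:
  "card (span c) + card (pivots i) \<le> card (span c \<inter> free_verts i) + 2 * card M"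
proof -
  have "span c \<subseteq> (span c \<inter> free_verts i) \<union> (covered - free_verts i)"
    using span_subset[of c] uncovered_free unfolding free_verts_def covered_def by blast
  then have "card (span c) \<le> card ((span c \<inter> free_verts i) \<union> (covered - free_verts i))"
    using finite_span finite_covered by (intro card_mono) auto
  also have "\<dots> \<le> card (span c \<inter> free_verts i) + card (covered - free_verts i)"
    by (rule card_Un_le)
  also have "card (covered - free_verts i) = card covered - card (covered \<inter> free_verts i)"
    using finite_covered by (simp add: card_Diff_subset_Int)
  finally show ?thesis
    using card_pivots_le[of i] card_covered_le card_mono[OF finite_covered, of "covered \<inter> free_verts i"]
    by auto
qed

end

section \<open>Growth of the set of pivots in one round\<close>

locale switching_colouring_matching = maximum_colouring_matching +
  fixes i :: nat
  assumes no_free_triple: "h \<in> triples C adj \<Longrightarrow> \<not> h \<subseteq> free i"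
begin

definition reached :: "'a \<Rightarrow> 'b set" where
  "reached z = {c \<in> free_colours i. \<exists>v \<in> free_verts i. adj c v z}"

lemma not_both_free:
  assumes "c \<in> free_colours i" "v \<in> free_verts i" "adj c u v"
  shows "u \<notin> free_verts i"
  using no_free_triple[OF triplesI[of c u v]] assms unfolding free_colours_def free_verts_def by auto

lemma finite_free_colours: "finite (free_colours i)"
  unfolding free_colours_def using finite_C by simp

lemma finite_reached: "finite (reached z)"
  unfolding reached_def using finite_free_colours by simp

text \<open>
  Double counting: a free vertex of the class of a free colour \<open>c\<close> has a \<open>c\<close>-neighbour, which is not
  free, and distinct free vertices get distinct neighbours since they lie in distinct cliques.
\<close>

lemma sum_span_free_le:
  "(\<Sum>c\<in>free_colours i. card (span c \<inter> free_verts i)) \<le> (\<Sum>z\<in>covered. card (reached z))"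
proof -
  define mate where "mate c v = (SOME u. adj c u v)" for c v
  have mate: "adj c (mate c v) v" if "v \<in> span c" for c v
    using that unfolding span_def mate_def by (auto intro: someI)
  define T where "T = Sigma (free_colours i) (\<lambda>c. span c \<inter> free_verts i)"
  define g where "g = (\<lambda>(c, v). (mate c v, c))"
  have T: "c \<in> free_colours i" "v \<in> free_verts i" "adj c (mate c v) v" if "(c, v) \<in> T" for c v
    using that mate unfolding T_def by auto
  have "inj_on g T"
  proof (rule inj_onI, clarify)
    fix c v c' v' assume a: "(c, v) \<in> T" "(c', v') \<in> T" "g (c, v) = g (c', v')"
    then have c: "c' = c" "mate c v = mate c v'" unfolding g_def by auto
    have "v = v'"
    proof (rule ccontr)
      assume "v \<noteq> v'"
      then have "adj c v v'"
        using adj_trans[OF adj_sym[OF T(3)[OF a(1)]]] T(3)[OF a(2)] c by simp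
      then show False using not_both_free[OF T(1)[OF a(1)] T(2)[OF a(2)[unfolded c]]] T(2)[OF a(1)] by simp
    qed
    then show "c = c' \<and> v = v'" using c by simp
  qed
  moreover have "g p \<in> Sigma covered reached" if p: "p \<in> T" for p
  proof -
    obtain c v where cv: "p = (c, v)" by (cases p)
    note t = T[OF p[unfolded cv]]
    have "mate c v \<notin> free_verts i" using not_both_free[OF t] .
    then have "mate c v \<in> covered"
      using uncovered_free adj_in_V[OF t(3)] unfolding free_verts_def covered_def by blast
    moreover have "c \<in> reached (mate c v)"
      using t adj_sym unfolding reached_def by blast
    ultimately show ?thesis unfolding g_def cv by simp
  qed
  ultimately have "card T \<le> card (Sigma covered reached)"
    using finite_covered finite_reached by (intro card_inj_on_le[of g] image_subsetI) auto
  moreover have "card T = (\<Sum>c\<in>free_colours i. card (span c \<inter> free_verts i))"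
    unfolding T_def using finite_free_colours finite_span by simp
  moreover have "card (Sigma covered reached) = (\<Sum>z\<in>covered. card (reached z))"
    using finite_covered finite_reached by simp
  ultimately show ?thesis by simp
qed

text \<open>Since \<open>z\<close> is not robust, some set \<open>B\<close> of at most
  \<open>b\<close> elements blocks it: each triple made of \<open>z\<close>, a free vertex and a
  free colour meets \<open>B\<close>. A vertex in \<open>B\<close> blocks at most \<mu> colours by
  the multiplicity bound, a colour in \<open>B\<close> only itself.\<close>

lemma card_reached_le:
  assumes z: "z \<in> covered - pivots (Suc i)"
    and mult: "\<And>u v. real (card {c \<in> C. adj c u v}) \<le> \<mu>" and \<mu>: "1 \<le> \<mu>"
  shows "real (card (reached z)) \<le> real b * \<mu>"
proof -
  have "\<not> robust (triples C adj) b (free i) (Inl z)" using z by simp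
  then obtain B where B: "finite B" "card B \<le> b"
      "\<And>f. f \<in> triples C adj \<Longrightarrow> Inl z \<in> f \<Longrightarrow> \<not> f - {Inl z} \<subseteq> free i - B"
    unfolding robust_def by blast
  define E where "E w = {c \<in> C. case w of Inl v \<Rightarrow> adj c v z | Inr c' \<Rightarrow> c = c'}" for w
  have "reached z \<subseteq> (\<Union>w\<in>B. E w)"
  proof
    fix c assume "c \<in> reached z"
    then obtain v where c: "c \<in> C" "Inr c \<in> free i" and v: "Inl v \<in> free i" "adj c v z"
      unfolding reached_def free_colours_def free_verts_def by blast
    have "\<not> {Inl v, Inl z, Inr c} - {Inl z} \<subseteq> free i - B"
      using B(3)[OF triplesI[OF c(1) v(2)]] by simp
    then have "Inl v \<in> B \<or> Inr c \<in> B" using c v by blast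
    then show "c \<in> (\<Union>w\<in>B. E w)"
      using c v unfolding E_def by (auto intro: bexI[of _ "Inl v"] bexI[of _ "Inr c"])
  qed
  then have "card (reached z) \<le> card (\<Union>w\<in>B. E w)"
    using B(1) finite_C unfolding E_def by (intro card_mono) auto
  also have "\<dots> \<le> (\<Sum>w\<in>B. card (E w))" by (rule card_UN_le[OF B(1)])
  finally have "real (card (reached z)) \<le> (\<Sum>w\<in>B. real (card (E w)))"
    by (metis of_nat_le_iff of_nat_sum)
  also have "\<dots> \<le> (\<Sum>w\<in>B. \<mu>)"
  proof (rule sum_mono)
    fix w
    show "real (card (E w)) \<le> \<mu>"
    proof (cases w)
      case (Inl v)
      then show ?thesis using mult[of v z] unfolding E_def by simp
    next
      case (Inr c)
      then have "E w \<subseteq> {c}" unfolding E_def by auto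
      then have "card (E w) \<le> 1" using card_mono[of "{c}" "E w"] by simp
      then show ?thesis using \<mu> by linarith
    qed
  qed
  also have "\<dots> \<le> real b * \<mu>" using B(2) \<mu> by (simp add: mult_right_mono)
  finally show ?thesis .
qed

text \<open>Count pairs of a free colour and a free vertex of its class, where \<open>z\<close> is
  the number of free colours. Each colour gives at least
  \<open>\<delta> * n + card (pivots i)\<close> pairs. On the other side, a pivot of the next level
  accounts for at most \<open>z\<close> pairs and every other covered vertex for at most
  \<open>b * \<mu>\<close>; the latter total at most \<open>2 * n * b * \<mu>\<close>, which
  \<open>missing\<close> bounds by \<open>\<delta> / 2 * n * z\<close>. Dividing by \<open>z\<close>
  gives the gain.\<close>

lemma card_pivots_Suc_ge:
  assumes \<delta>: "\<delta> > 0" and span: "\<And>c. c \<in> C \<Longrightarrow> (2 + \<delta>) * real (card C) \<le> real (card (span c))"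
    and mult: "\<And>u v. real (card {c \<in> C. adj c u v}) \<le> \<mu>" and \<mu>: "1 \<le> \<mu>"
    and missing: "4 * real b * \<mu> / \<delta> < real (card C - card M)"
  shows "real (card (pivots i)) + \<delta> / 2 * real (card C) \<le> real (card (pivots (Suc i)))"
proof -
  define n where "n = real (card C)"
  define z where "z = real (card (free_colours i))"
  have "{c \<in> C. Inr c \<notin> \<Union>M} \<subseteq> free_colours i"
    unfolding free_colours_def using uncovered_free by blast
  then have "card C - card M \<le> card (free_colours i)"
    using card_missing card_mono[OF finite_free_colours] by metis
  then have z: "4 * real b * \<mu> / \<delta> < z" unfolding z_def using missing by linarith
  have bmu: "0 \<le> real b * \<mu>" using \<mu> by simp
  have "0 \<le> 4 * real b * \<mu> / \<delta>" using \<mu> \<delta> by simp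
  then have z0: "0 < z" using z by linarith
  have z1: "4 * (real b * \<mu>) \<le> \<delta> * z" using z \<delta> by (simp add: pos_divide_less_eq mult_ac)
  have m: "real (card M) \<le> n" unfolding n_def using card_M_le by simp
  have "z * (\<delta> * n + real (card (pivots i))) = (\<Sum>c\<in>free_colours i. \<delta> * n + real (card (pivots i)))"
    unfolding z_def by simp
  also have "\<dots> \<le> (\<Sum>c\<in>free_colours i. real (card (span c \<inter> free_verts i)))"
  proof (rule sum_mono)
    fix c assume "c \<in> free_colours i"
    then have "c \<in> C" unfolding free_colours_def by simp
    then have "2 * n + \<delta> * n \<le> real (card (span c))"
      using span unfolding n_def by (simp add: algebra_simps)
    moreover have "real (card (span c)) + real (card (pivots i)) \<le>
        real (card (span c \<inter> free_verts i)) + 2 * real (card M)"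
      using card_span_free_ge[of c i] by linarith
    ultimately show "\<delta> * n + real (card (pivots i)) \<le> real (card (span c \<inter> free_verts i))"
      using m by linarith
  qed
  also have "\<dots> \<le> (\<Sum>z\<in>covered. real (card (reached z)))"
    using sum_span_free_le by (metis of_nat_le_iff of_nat_sum)
  also have "\<dots> = (\<Sum>z\<in>pivots (Suc i). real (card (reached z))) +
      (\<Sum>z\<in>covered - pivots (Suc i). real (card (reached z)))"
    using sum.subset_diff[OF pivots_subset finite_covered] by (simp only: add.commute)
  also have "(\<Sum>x\<in>pivots (Suc i). real (card (reached x))) \<le> (\<Sum>x\<in>pivots (Suc i). z)"
    unfolding z_def reached_def using finite_free_colours
    by (intro sum_mono) (auto intro!: card_mono)
  also have "\<dots> = real (card (pivots (Suc i))) * z" by simp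
  also have "(\<Sum>x\<in>covered - pivots (Suc i). real (card (reached x))) \<le>
      (\<Sum>x\<in>covered - pivots (Suc i). real b * \<mu>)"
    using card_reached_le[OF _ mult \<mu>] by (rule sum_mono)
  also have "\<dots> \<le> real (card covered) * (real b * \<mu>)"
    using bmu finite_covered by (auto intro!: mult_right_mono card_mono simp del: pivots.simps)
  also have "\<dots> \<le> (2 * n) * (real b * \<mu>)"
    using bmu card_covered_le m by (intro mult_right_mono) linarith+
  also have "\<dots> \<le> n / 2 * (\<delta> * z)"
    using mult_left_mono[OF z1, of "n / 2"] unfolding n_def by (simp add: mult_ac)
  finally have "z * (\<delta> * n + real (card (pivots i))) \<le> z * (real (card (pivots (Suc i))) + \<delta> / 2 * n)"
    by (simp add: algebra_simps)
  then have "\<delta> * n + real (card (pivots i)) \<le> real (card (pivots (Suc i))) + \<delta> / 2 * n"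
    using z0 by simp
  then show ?thesis unfolding n_def by (simp add: algebra_simps)
qed

end

text \<open>More than \<open>4 / \<delta>\<close> rounds, each gaining
  \<open>\<delta> / 2 * card C\<close> pivots, would produce more than \<open>2 * card C\<close> of
  them, but all pivots are covered vertices.\<close>

lemma few_missing_colours:
  fixes \<delta> :: real
  assumes \<delta>: "\<delta> > 0"
  shows "\<exists>K. \<forall>V (C :: 'c set) (adj :: 'c \<Rightarrow> 'v \<Rightarrow> 'v \<Rightarrow> bool) M \<mu>.
     clique_colouring V C adj \<longrightarrow> max_matching (triples C adj) M \<longrightarrow>
     (\<forall>c \<in> C. (2 + \<delta>) * real (card C) \<le> real (card {v. \<exists>u. adj c u v})) \<longrightarrow>
     1 \<le> \<mu> \<longrightarrow> (\<forall>u v. real (card {c \<in> C. adj c u v}) \<le> \<mu>) \<longrightarrow>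
     real (card C - card M) \<le> K * \<mu>"
proof -
  define k where "k = nat \<lceil>4 / \<delta>\<rceil> + 1"
  have k: "4 / \<delta> < real k" unfolding k_def by linarith
  have "\<forall>i. \<exists>s b\<^sub>0. \<forall>(H :: ('v + 'c) set set) M b. max_matching H M \<longrightarrow> b\<^sub>0 \<le> b \<longrightarrow>
     switchable H M (freeable H (range Inl) M b i) 3 3 s"
    using freeable_switchable by blast
  then obtain s b\<^sub>0 where S: "\<And>i (H :: ('v + 'c) set set) M b. max_matching H M \<Longrightarrow> b\<^sub>0 i \<le> b \<Longrightarrow>
     switchable H M (freeable H (range Inl) M b i) 3 3 (s i)"
    by metis
  \<comment> \<open>The sum dominates the threshold of every round, so one value of \<open>b\<close>
    works throughout. It is fixed before the graph, which makes \<open>4 * b / \<delta>\<close> a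
    legitimate \<open>K\<close>.\<close>
  define b where "b = (\<Sum>i<k. b\<^sub>0 i)"
  have b: "b\<^sub>0 i \<le> b" if "i < k" for i
    unfolding b_def using that by (intro member_le_sum) auto
  have "real (card C - card M) \<le> 4 * real b / \<delta> * \<mu>"
    if cl: "clique_colouring V C adj" and max: "max_matching (triples C adj) M"
      and span: "\<forall>c \<in> C. (2 + \<delta>) * real (card C) \<le> real (card {v. \<exists>u. adj c u v})"
      and \<mu>: "1 \<le> \<mu>" and mult: "\<forall>u v. real (card {c \<in> C. adj c u v}) \<le> \<mu>"
    for V and C :: "'c set" and adj :: "'c \<Rightarrow> 'v \<Rightarrow> 'v \<Rightarrow> bool" and M \<mu>
  proof (rule ccontr)
    assume "\<not> ?thesis"
    then have missing: "4 * real b * \<mu> / \<delta> < real (card C - card M)" by simp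
    interpret maximum_colouring_matching V C adj M b
      using cl max by (simp add: maximum_colouring_matching_def maximum_colouring_matching_axioms_def)
    have grow: "real (card (pivots i)) + \<delta> / 2 * real (card C) \<le> real (card (pivots (Suc i)))"
      if i: "i < k" for i
    proof -
      \<comment> \<open>Switchability enters the counting only through the absence of an edge among
        free elements.\<close>
      interpret switching_colouring_matching V C adj M b i
        using switchable_no_edge[OF max S[OF max b[OF i]]] by unfold_locales blast
      show ?thesis
        using span mult by (intro card_pivots_Suc_ge[OF \<delta> _ _ \<mu> missing]) (auto simp: span_def)
    qed
    have "real i * (\<delta> / 2 * real (card C)) \<le> real (card (pivots i))" if "i \<le> k" for i
      using that
    proof (induction i)
      case (Suc i)
      then show ?case using grow[of i] by (simp add: algebra_simps)
    qed simp
    then have "real k * (\<delta> / 2 * real (card C)) \<le> real (card (pivots k))" by simp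
    also have "\<dots> \<le> 2 * real (card C)"
      using card_mono[OF finite_covered pivots_subset[of k]] card_covered_le card_M_le by linarith
    finally have "(real k * \<delta> / 4) * real (card C) \<le> 1 * real (card C)" by simp
    moreover have "0 < card C"
    proof -
      have "0 \<le> 4 * real b * \<mu> / \<delta>" using \<mu> \<delta> by simp
      then show ?thesis using missing by linarith
    qed
    ultimately have "real k * \<delta> / 4 \<le> 1" by (metis mult_le_cancel_right_pos of_nat_0_less_iff)
    then show False using k \<delta> by (simp add: pos_divide_less_eq)
  qed
  then show ?thesis by blast
qed

subsection \<open>Random subsets\<close>

text \<open>The expectation of \<open>F R\<close>, where \<open>R\<close> contains each element of \<open>A\<close> independently with probability \<open>p\<close>.\<close>

definition avg :: "real \<Rightarrow> 'a set \<Rightarrow> ('a set \<Rightarrow> real) \<Rightarrow> real" where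
  "avg p A F = (\<Sum>R\<in>Pow A. p ^ card R * (1 - p) ^ card (A - R) * F R)"

lemma avg_empty [simp]: "avg p {} F = F {}"
  by (simp add: avg_def)

lemma avg_singleton: "avg p {a} F = (1 - p) * F {} + p * F {a}"
proof -
  have "Pow {a} = {{}, {a}}" by auto
  then show ?thesis by (simp add: avg_def)
qed

text \<open>Independence of the choices in \<open>A\<close> and in \<open>B\<close>: the weight of a
  union is the product of the weights.\<close>

lemma avg_Un:
  assumes fin: "finite A" "finite B" and disj: "A \<inter> B = {}"
  shows "avg p (A \<union> B) F = avg p A (\<lambda>R. avg p B (\<lambda>S. F (R \<union> S)))"
proof -
  define w where "w A R = p ^ card R * (1 - p) ^ card (A - R)" for A R :: "'a set"
  have w: "w (A \<union> B) (R \<union> S) = w A R * w B S" if "R \<subseteq> A" "S \<subseteq> B" for R S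
  proof -
    have "card (R \<union> S) = card R + card S"
      using that fin disj by (intro card_Un_disjoint) (auto intro: finite_subset)
    moreover have "(A \<union> B) - (R \<union> S) = (A - R) \<union> (B - S)" using that disj by blast
    moreover have "card ((A - R) \<union> (B - S)) = card (A - R) + card (B - S)"
      using fin disj by (intro card_Un_disjoint) auto
    ultimately show ?thesis unfolding w_def by (simp add: power_add)
  qed
  have bij: "bij_betw (\<lambda>(R, S). R \<union> S) (Pow A \<times> Pow B) (Pow (A \<union> B))"
  proof (rule bij_betw_byWitness[where f' = "\<lambda>R. (R \<inter> A, R \<inter> B)"])
    show "\<forall>x\<in>Pow A \<times> Pow B. ((case x of (R, S) \<Rightarrow> R \<union> S) \<inter> A, (case x of (R, S) \<Rightarrow> R \<union> S) \<inter> B) = x"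
      using disj by auto
  qed auto
  have "avg p (A \<union> B) F = (\<Sum>R\<in>Pow (A \<union> B). w (A \<union> B) R * F R)"
    unfolding avg_def w_def by simp
  also have "\<dots> = (\<Sum>(R, S)\<in>Pow A \<times> Pow B. w (A \<union> B) (R \<union> S) * F (R \<union> S))"
    by (subst sum.reindex_bij_betw[OF bij, symmetric]) (simp add: case_prod_unfold)
  also have "\<dots> = (\<Sum>(R, S)\<in>Pow A \<times> Pow B. w A R * (w B S * F (R \<union> S)))"
    by (rule sum.cong) (auto simp: w)
  also have "\<dots> = (\<Sum>R\<in>Pow A. \<Sum>S\<in>Pow B. w A R * (w B S * F (R \<union> S)))"
    by (simp add: sum.cartesian_product)
  also have "\<dots> = avg p A (\<lambda>R. avg p B (\<lambda>S. F (R \<union> S)))"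
    unfolding avg_def w_def by (simp add: sum_distrib_left)
  finally show ?thesis .
qed

section \<open>Linearity and independence for averages\<close>

lemma avg_cong:
  "(\<And>R. R \<subseteq> A \<Longrightarrow> F R = G R) \<Longrightarrow> avg p A F = avg p A G"
  unfolding avg_def by (intro sum.cong) auto

lemma avg_cmult: "avg p A (\<lambda>R. c * F R) = c * avg p A F"
  unfolding avg_def sum_distrib_left by (simp add: mult_ac)

lemma avg_cmult_right: "avg p A (\<lambda>R. F R * c) = avg p A F * c"
  unfolding avg_def sum_distrib_right by (simp add: mult_ac)

lemma avg_add: "avg p A (\<lambda>R. F R + G R) = avg p A F + avg p A G"
  unfolding avg_def by (simp add: sum.distrib distrib_left)

lemma avg_sum: "avg p A (\<lambda>R. \<Sum>i\<in>I. F i R) = (\<Sum>i\<in>I. avg p A (F i))"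
  unfolding avg_def by (subst sum.swap) (simp add: sum_distrib_left)

lemma avg_const:
  assumes "finite A" shows "avg p A (\<lambda>_. c) = c"
  using assms
proof induction
  case (insert a A)
  then have "avg p ({a} \<union> A) (\<lambda>_. c) = c" by (subst avg_Un) (auto simp: avg_singleton algebra_simps)
  then show ?case by simp
qed simp

text \<open>First moment method: the minimum of \<open>F\<close> is at most its average, because the
  weights sum to 1.\<close>

lemma ex_le_avg:
  assumes "finite A" "0 \<le> p" "p \<le> 1"
  shows "\<exists>R \<subseteq> A. F R \<le> avg p A F"
proof (rule ccontr)
  assume "\<not> ?thesis"
  then have less: "avg p A F < F R" if "R \<subseteq> A" for R
    using that by (meson not_le)
  obtain R where R: "R \<in> F ` Pow A" "\<And>y. y \<in> F ` Pow A \<Longrightarrow> R \<le> y"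
    using assms(1) Min_in[of "F ` Pow A"] Min_le[of "F ` Pow A"] by blast
  have "R = avg p A (\<lambda>_. R)" using avg_const[OF assms(1)] by simp
  also have "\<dots> \<le> avg p A F"
    unfolding avg_def using assms R(2) by (intro sum_mono mult_left_mono) auto
  finally show False using less R(1) by (auto simp: not_le[symmetric])
qed

text \<open>The choices outside \<open>A\<close> have total weight 1 and are summed out.\<close>

lemma avg_restrict:
  assumes "finite V" "A \<subseteq> V"
  shows "avg p V (\<lambda>R. F (R \<inter> A)) = avg p A F"
proof -
  have fin: "finite A" "finite (V - A)" using assms finite_subset by auto
  have "avg p (A \<union> (V - A)) (\<lambda>R. F (R \<inter> A)) =
      avg p A (\<lambda>R. avg p (V - A) (\<lambda>S. F ((R \<union> S) \<inter> A)))"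
    using fin by (intro avg_Un) auto
  also have "\<dots> = avg p A (\<lambda>R. avg p (V - A) (\<lambda>S. F R))"
  proof (intro avg_cong)
    fix R S assume "R \<subseteq> A" "S \<subseteq> V - A"
    then have "(R \<union> S) \<inter> A = R" by blast
    then show "F ((R \<union> S) \<inter> A) = F R" by simp
  qed
  finally show ?thesis using assms(2) fin by (simp add: avg_const Un_absorb1)
qed

text \<open>Factors that depend on disjoint blocks are independent, so the average of their product
  is the product of their averages.\<close>

lemma avg_prod_blocks:
  assumes "finite I" "\<And>i. i \<in> I \<Longrightarrow> finite (e i)" "disjoint_family_on e I"
  shows "avg p (\<Union>i\<in>I. e i) (\<lambda>R. \<Prod>i\<in>I. g i (R \<inter> e i)) = (\<Prod>i\<in>I. avg p (e i) (g i))"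
  using assms
proof (induction I)
  case (insert i I)
  have disj: "e i \<inter> (\<Union>j\<in>I. e j) = {}" "disjoint_family_on e I"
    using insert.prems(2) insert.hyps(2) unfolding disjoint_family_on_def by auto
  have "avg p (e i \<union> (\<Union>j\<in>I. e j)) (\<lambda>R. \<Prod>j\<in>insert i I. g j (R \<inter> e j)) =
      avg p (e i) (\<lambda>R. avg p (\<Union>j\<in>I. e j) (\<lambda>S. \<Prod>j\<in>insert i I. g j ((R \<union> S) \<inter> e j)))"
    using insert.hyps insert.prems(1) disj by (intro avg_Un) auto
  also have "\<dots> = avg p (e i) (\<lambda>R. avg p (\<Union>j\<in>I. e j) (\<lambda>S. g i R * (\<Prod>j\<in>I. g j (S \<inter> e j))))"
  proof (intro avg_cong)
    fix R S assume RS: "R \<subseteq> e i" "S \<subseteq> (\<Union>j\<in>I. e j)"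
    have "(R \<union> S) \<inter> e i = R" using RS disj(1) by blast
    moreover have "(R \<union> S) \<inter> e j = S \<inter> e j" if "j \<in> I" for j using RS disj(1) that by blast
    ultimately show "(\<Prod>j\<in>insert i I. g j ((R \<union> S) \<inter> e j)) = g i R * (\<Prod>j\<in>I. g j (S \<inter> e j))"
      using insert.hyps by simp
  qed
  also have "\<dots> = avg p (e i) (g i) * avg p (\<Union>j\<in>I. e j) (\<lambda>S. \<Prod>j\<in>I. g j (S \<inter> e j))"
    by (simp add: avg_cmult avg_cmult_right)
  also have "\<dots> = avg p (e i) (g i) * (\<Prod>j\<in>I. avg p (e j) (g j))"
    using insert.IH insert.prems(1) disj(2) by simp
  finally show ?case using insert.hyps by simp
qed simp

text \<open>An exponential moment of a binomial variable: each element of \<open>A\<close>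
  contributes the factor 2 with probability \<open>p\<close> and 1 otherwise.\<close>

lemma avg_two_power:
  assumes "finite V" "A \<subseteq> V"
  shows "avg p V (\<lambda>R. 2 ^ card (R \<inter> A)) = (1 + p) ^ card A"
proof -
  have fin: "finite A" using assms finite_subset by auto
  have *: "(2 :: real) ^ card R = (\<Prod>a\<in>A. if R \<inter> {a} = {} then 1 else 2)" if "R \<subseteq> A" for R
  proof -
    have "(\<Prod>a\<in>A. if R \<inter> {a} = {} then 1 else (2::real)) = (\<Prod>a\<in>A. if a \<in> R then 2 else 1)"
      by (intro prod.cong) auto
    also have "\<dots> = (\<Prod>a\<in>A \<inter> R. 2)" by (rule prod.inter_restrict[OF fin, symmetric])
    finally show ?thesis using that by (simp add: Int_absorb1)
  qed
  have "avg p V (\<lambda>R. 2 ^ card (R \<inter> A)) = avg p A (\<lambda>R. 2 ^ card R)"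
    by (rule avg_restrict[OF assms])
  also have "\<dots> = avg p (\<Union>a\<in>A. {a}) (\<lambda>R. \<Prod>a\<in>A. if R \<inter> {a} = {} then 1 else 2)"
    using * by (auto intro: avg_cong)
  also have "\<dots> = (\<Prod>a\<in>A. avg p {a} (\<lambda>R. if R = {} then 1 else 2))"
    using fin by (intro avg_prod_blocks) (auto simp: disjoint_family_on_def)
  also have "\<dots> = (1 + p) ^ card A" by (simp add: avg_singleton add.commute)
  finally show ?thesis .
qed

text \<open>The pairs are disjoint, hence independent. Each lies inside \<open>R\<close> with
  probability \<open>p\<^sup>2\<close> and then contributes the factor 1/2.\<close>

lemma avg_half_power:
  assumes "finite V" "\<Union>S \<subseteq> V" "disjoint S" and two: "\<And>e. e \<in> S \<Longrightarrow> card e = 2"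
  shows "avg p V (\<lambda>R. (1 / 2) ^ card {e \<in> S. e \<subseteq> R}) = (1 - p\<^sup>2 / 2) ^ card S"
proof -
  have fin: "finite (\<Union>S)" "finite S"
    using finite_subset[OF assms(2,1)] finite_UnionD by auto
  have *: "(1 / 2 :: real) ^ card {e \<in> S. e \<subseteq> R} = (\<Prod>e\<in>S. if e \<subseteq> R \<inter> e then 1 / 2 else 1)" for R
  proof -
    have "(\<Prod>e\<in>S. if e \<subseteq> R \<inter> e then 1 / 2 else (1::real)) = (\<Prod>e\<in>S. if e \<in> {e. e \<subseteq> R} then 1 / 2 else 1)"
      by (intro prod.cong) auto
    also have "\<dots> = (\<Prod>e\<in>S \<inter> {e. e \<subseteq> R}. 1 / 2)"
      by (rule prod.inter_restrict[OF fin(2), symmetric])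
    finally show ?thesis by (simp add: Int_def)
  qed
  have block: "avg p e (\<lambda>R. if e \<subseteq> R then 1 / 2 else 1) = 1 - p\<^sup>2 / 2" if "e \<in> S" for e
  proof -
    obtain u v where e: "e = {u} \<union> {v}" "u \<noteq> v"
      using two[OF \<open>e \<in> S\<close>] by (metis card_2_iff insert_is_Un)
    show ?thesis unfolding e(1) using e(2)
      by (subst avg_Un) (auto simp: avg_singleton power2_eq_square algebra_simps)
  qed
  have "avg p V (\<lambda>R. (1 / 2) ^ card {e \<in> S. e \<subseteq> R}) =
      avg p V (\<lambda>R. (\<Prod>e\<in>S. if e \<subseteq> (R \<inter> \<Union>S) \<inter> e then 1 / 2 else 1))"
    unfolding * by (intro avg_cong prod.cong) auto
  also have "\<dots> = avg p (\<Union>S) (\<lambda>R. (\<Prod>e\<in>S. if e \<subseteq> R \<inter> e then 1 / 2 else 1))"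
    by (rule avg_restrict[OF assms(1,2)])
  also have "\<dots> = avg p (\<Union>e\<in>S. e) (\<lambda>R. (\<Prod>e\<in>S. if e \<subseteq> R \<inter> e then 1 / 2 else 1))" by simp
  also have "\<dots> = (\<Prod>e\<in>S. avg p e (\<lambda>R. if e \<subseteq> R then 1 / 2 else 1))"
    using fin assms(3) two
    by (intro avg_prod_blocks) (auto simp: disjoint_family_on_def disjoint_def intro: card_ge_0_finite)
  also have "\<dots> = (1 - p\<^sup>2 / 2) ^ card S" using block by simp
  finally show ?thesis .
qed

text \<open>Chernoff bounds for both requirements, combined by a union bound over the
  colours.\<close>

lemma ex_sparse_set_with_many_pairs:
  fixes p m :: real and C :: "'c set" and X :: "'c \<Rightarrow> 'v set" and S :: "'c \<Rightarrow> 'v set set"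
  assumes finV: "finite V" and finC: "finite C" and p: "0 < p" "p \<le> 1" and m: "0 \<le> m"
    and X: "\<And>c. c \<in> C \<Longrightarrow> X c \<subseteq> V" "\<And>c. c \<in> C \<Longrightarrow> m \<le> real (card (X c))"
    and S: "\<And>c. c \<in> C \<Longrightarrow> \<Union>(S c) \<subseteq> V" "\<And>c. c \<in> C \<Longrightarrow> disjoint (S c)"
      "\<And>c e. c \<in> C \<Longrightarrow> e \<in> S c \<Longrightarrow> card e = 2" "\<And>c. c \<in> C \<Longrightarrow> m / 3 \<le> real (card (S c))"
    and y: "real (card C) * (exp (- p * m) + 2 ^ y * exp (- p\<^sup>2 * m / 6)) < 1"
  shows "\<exists>R \<subseteq> V. \<forall>c \<in> C. real (card (R \<inter> X c)) \<le> 4 * p * real (card (X c)) \<and>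
    y \<le> card {e \<in> S c. e \<subseteq> R}"
proof -
  \<comment> \<open>A penalty that is at least 1 as soon as \<open>R\<close> takes too much of
    \<open>X c\<close> or contains fewer than \<open>y\<close> pairs of \<open>S c\<close>. The
    first moment method then gives an \<open>R\<close> whose total penalty is below 1.\<close>
  define F where "F c R = 2 ^ card (R \<inter> X c) * exp (- 2 * p * real (card (X c))) +
      2 ^ y * (1 / 2) ^ card {e \<in> S c. e \<subseteq> R}" for c R
  have F0: "0 \<le> F c R" for c R unfolding F_def by simp
  have "avg p V (F c) \<le> exp (- p * m) + 2 ^ y * exp (- p\<^sup>2 * m / 6)" if c: "c \<in> C" for c
  proof -
    have "(1 + p) ^ card (X c) \<le> exp p ^ card (X c)"
      using p exp_ge_add_one_self[of p] by (intro power_mono) auto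
    also have "\<dots> = exp (p * real (card (X c)))"
      by (simp add: exp_of_nat_mult[symmetric] mult.commute)
    finally have "(1 + p) ^ card (X c) * exp (- 2 * p * real (card (X c)))
        \<le> exp (p * real (card (X c))) * exp (- 2 * p * real (card (X c)))"
      by (intro mult_right_mono) auto
    also have "\<dots> = exp (- p * real (card (X c)))"
      by (simp add: exp_add[symmetric])
    also have "\<dots> \<le> exp (- p * m)" using X(2)[OF c] p by simp
    finally have 1: "(1 + p) ^ card (X c) * exp (- 2 * p * real (card (X c))) \<le> exp (- p * m)" .
    have "p\<^sup>2 \<le> 1" using p by (simp add: power_le_one)
    then have "(1 - p\<^sup>2 / 2) ^ card (S c) \<le> exp (- p\<^sup>2 / 2) ^ card (S c)"
      using exp_ge_add_one_self[of "- p\<^sup>2 / 2"] by (intro power_mono) auto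
    also have "\<dots> = exp (- p\<^sup>2 / 2 * real (card (S c)))"
      by (simp add: exp_of_nat_mult[symmetric] mult.commute)
    also have "\<dots> \<le> exp (- p\<^sup>2 * m / 6)"
      using mult_left_mono[OF S(4)[OF c], of "p\<^sup>2 / 2"] by simp
    finally have 2: "2 ^ y * (1 - p\<^sup>2 / 2) ^ card (S c) \<le> 2 ^ y * exp (- p\<^sup>2 * m / 6)"
      by simp
    have "avg p V (F c) = (1 + p) ^ card (X c) * exp (- 2 * p * real (card (X c))) +
        2 ^ y * (1 - p\<^sup>2 / 2) ^ card (S c)"
      unfolding F_def avg_add avg_cmult avg_cmult_right
      by (simp add: avg_two_power[OF finV X(1)[OF c]] avg_half_power[OF finV S(1)[OF c] S(2)[OF c] S(3)[OF c]])
    then show ?thesis using 1 2 by linarith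
  qed
  then have "(\<Sum>c\<in>C. avg p V (F c)) \<le> (\<Sum>c\<in>C. exp (- p * m) + 2 ^ y * exp (- p\<^sup>2 * m / 6))"
    by (rule sum_mono)
  then have "(\<Sum>c\<in>C. avg p V (F c)) < 1" using y by simp
  then have lt1: "avg p V (\<lambda>R. \<Sum>c\<in>C. F c R) < 1" unfolding avg_sum .
  obtain R where R: "R \<subseteq> V" "(\<Sum>c\<in>C. F c R) \<le> avg p V (\<lambda>R. \<Sum>c\<in>C. F c R)"
    using ex_le_avg[OF finV, of p "\<lambda>R. \<Sum>c\<in>C. F c R"] p by auto
  have F1: "F c R < 1" if "c \<in> C" for c
    using member_le_sum[of c C "\<lambda>c. F c R"] that F0 finC R(2) lt1 by force
  show ?thesis
  proof (intro exI[of _ R] conjI ballI)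
    fix c assume c: "c \<in> C"
    define N where "N = real (card (X c))"
    have "2 ^ card (R \<inter> X c) * exp (- 2 * p * N) < 1" "2 ^ y * (1 / 2) ^ card {e \<in> S c. e \<subseteq> R} < (1::real)"
      using F1[OF c] unfolding F_def N_def by (smt (verit) exp_gt_zero mult_nonneg_nonneg zero_le_power divide_nonneg_pos)+
    then have a: "2 ^ card (R \<inter> X c) < exp (2 * p * N)" and b: "(2::real) ^ y < 2 ^ card {e \<in> S c. e \<subseteq> R}"
      by (simp_all add: exp_minus field_simps power_one_over)
    have "real (card (R \<inter> X c)) * ln 2 = ln (2 ^ card (R \<inter> X c))" by (simp add: ln_realpow)
    also have "\<dots> < ln (exp (2 * p * N))" using a by (subst ln_less_cancel_iff) auto
    finally have "real (card (R \<inter> X c)) * ln 2 < 2 * p * N" by simp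
    \<comment> \<open>This estimate turns the factor \<open>2 * p\<close> into
      \<open>4 * p\<close>.\<close>
    moreover have "1 / 2 \<le> ln (2 :: real)"
      using ln_le_minus_one[of "1 / 2"] by (simp add: ln_div)
    then have "real (card (R \<inter> X c)) * (1 / 2) \<le> real (card (R \<inter> X c)) * ln 2"
      by (intro mult_left_mono) auto
    ultimately show "real (card (R \<inter> X c)) \<le> 4 * p * real (card (X c))" unfolding N_def by linarith
    show "y \<le> card {e \<in> S c. e \<subseteq> R}" using b by simp
  qed (rule R(1))
qed

subsection \<open>Completing the matching\<close>

text \<open>Greedy choice: the pairs chosen for \<open>Q\<close> cover at most
  \<open>2 * card Q\<close> vertices, each of which spoils at most one member of the disjoint family
  \<open>S c\<close>.\<close>

lemma ex_disjoint_choice: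
  assumes "finite Q"
    and "\<And>c. c \<in> Q \<Longrightarrow> disjoint (S c)" "\<And>c e. c \<in> Q \<Longrightarrow> e \<in> S c \<Longrightarrow> card e = 2"
      "\<And>c. c \<in> Q \<Longrightarrow> 2 * card Q \<le> card (S c)"
  shows "\<exists>f. (\<forall>c \<in> Q. f c \<in> S c) \<and> disjoint_family_on f Q"
  using assms
proof (induction Q)
  case (insert c Q)
  have "\<exists>f. (\<forall>c \<in> Q. f c \<in> S c) \<and> disjoint_family_on f Q"
  proof (rule insert.IH)
    fix c' assume "c' \<in> Q"
    then show "2 * card Q \<le> card (S c')" using insert.prems(3)[of c'] insert.hyps by simp
  qed (use insert.prems(1,2) in auto)
  then obtain f where f: "\<And>c. c \<in> Q \<Longrightarrow> f c \<in> S c" "disjoint_family_on f Q" by blast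
  define W where "W = (\<Union>c\<in>Q. f c)"
  have two: "card (f c') = 2" if "c' \<in> Q" for c'
    by (rule insert.prems(2)[OF insertI2[OF that] f(1)[OF that]])
  then have finW: "finite W" unfolding W_def using insert.hyps(1)
    by (intro finite_UN_I) (auto intro: card_ge_0_finite)
  have "card W \<le> (\<Sum>c\<in>Q. card (f c))" unfolding W_def by (rule card_UN_le[OF insert.hyps(1)])
  then have cW: "card W \<le> 2 * card Q" using two by simp
  have "card {e \<in> S c. e \<inter> W \<noteq> {}} \<le> card W"
    using insert.prems(1) finW by (intro card_roots_le) auto
  then have less: "card {e \<in> S c. e \<inter> W \<noteq> {}} < card (S c)"
    using cW insert.prems(3)[of c] insert.hyps by simp
  have "\<exists>e \<in> S c. e \<inter> W = {}"
  proof (rule ccontr)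
    assume "\<not> ?thesis"
    then have "{e \<in> S c. e \<inter> W \<noteq> {}} = S c" by blast
    then show False using less by simp
  qed
  then obtain e where e: "e \<in> S c" "e \<inter> W = {}" by blast
  have "disjoint_family_on (f(c := e)) (insert c Q)"
    using f(2) e(2) insert.hyps(2) unfolding disjoint_family_on_def W_def by auto
  moreover have "\<forall>c' \<in> insert c Q. (f(c := e)) c' \<in> S c'"
    using f(1) e(1) insert.hyps(2) by auto
  ultimately show ?case by blast
qed (simp add: disjoint_family_on_def)

section \<open>Disjoint pairs in a colour class, deletion of a vertex set, and gluing\<close>

context clique_colouring
begin

lemma card_adj: "adj c u v \<Longrightarrow> card {u, v} = 2"
  using adj_irrefl[of c u] by (cases "u = v") auto

text \<open>A largest disjoint family \<open>S\<close> of pairs leaves at most one vertex uncovered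
  in each clique, and such a vertex has a neighbour in some pair of \<open>S\<close>. Pairs and
  leftover vertices together give at most \<open>2 * card S + card S\<close> vertices.\<close>

lemma ex_disjoint_pairs:
  "\<exists>S. S \<subseteq> {{u, v} | u v. adj c u v} \<and> disjoint S \<and> card (span c) \<le> 3 * card S"
proof -
  define E where "E = {{u, v} | u v. adj c u v}"
  have EV: "e \<subseteq> V" "card e = 2" if "e \<in> E" for e
    using that adj_in_V adj_in_V2 card_adj unfolding E_def by auto
  have "finite E" using EV(1) finite_V by (intro finite_subset[of E "Pow V"]) auto
  then obtain S where S: "S \<subseteq> E" "disjoint S" "\<And>N. N \<subseteq> E \<Longrightarrow> disjoint N \<Longrightarrow> card N \<le> card S"
    by (rule ex_max_disjoint) blast
  have finS: "finite S" using S(1) \<open>finite E\<close> by (rule finite_subset)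
  have maximal: "u \<in> \<Union>S \<or> v \<in> \<Union>S" if "adj c u v" for u v
  proof (rule ccontr)
    assume "\<not> ?thesis"
    then have uv: "{u, v} \<inter> \<Union>S = {}" by blast
    have "{u, v} \<notin> S" using uv by blast
    moreover have "card (insert {u, v} S) \<le> card S"
      using S(1) that unfolding E_def by (intro S(3)[unfolded E_def] disjoint_insertI[OF S(2) uv]) blast
    ultimately show False using finS by simp
  qed
  define U where "U = span c - \<Union>S"
  have ex: "\<exists>e m. e \<in> S \<and> m \<in> e \<and> adj c m v" if "v \<in> U" for v
    using that maximal unfolding U_def span_def by blast
  then obtain g m where g: "\<And>v. v \<in> U \<Longrightarrow> g v \<in> S \<and> m v \<in> g v \<and> adj c (m v) v" by metis
  have "inj_on g U"
  proof (rule inj_onI, rule ccontr)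
    fix v v' assume v: "v \<in> U" "v' \<in> U" "g v = g v'" "v \<noteq> v'"
    obtain a b where ab: "g v = {a, b}" "adj c a b"
      using S(1) g[OF v(1)] unfolding E_def by blast
    have "m v = m v' \<or> adj c (m v) (m v')"
    proof -
      have "m v \<in> {a, b}" "m v' \<in> {a, b}"
        using g[OF v(1)] g[OF v(2)] unfolding v(3)[symmetric] ab(1) by blast+
      then show ?thesis using ab(2) adj_sym[OF ab(2)] by auto
    qed
    \<comment> \<open>Only \<open>m v'\<close> is covered by \<open>S\<close>. The inequality is
      required because \<open>adj_trans\<close> asks for distinct ends.\<close>
    moreover have vm: "v \<noteq> m v'"
      using v(1) g[OF v(2)] unfolding U_def by blast
    ultimately have "adj c v (m v')"
      using g[OF v(1)] adj_sym[of c "m v" v] adj_trans[of c v "m v" "m v'"] by auto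
    then have "adj c v v'" using adj_trans[of c v "m v'" v'] g[OF v(2)] v(4) by blast
    then show False using maximal v(1,2) unfolding U_def by blast
  qed
  then have "card U \<le> card S" using g finS by (intro card_inj_on_le[of g]) auto
  moreover have "card (\<Union>S) \<le> 2 * card S"
  proof -
    have "card (\<Union>S) \<le> sum card S" by (rule card_Union_le_sum_card)
    also have "\<dots> = (\<Sum>e\<in>S. 2)" using EV(2) S(1) by (intro sum.cong) auto
    finally show ?thesis by simp
  qed
  moreover have "card (span c) \<le> card (\<Union>S \<union> U)"
  proof (rule card_mono)
    have "finite (\<Union>S)" using EV(1) S(1) finite_V by (meson Union_least finite_subset subset_iff)
    then show "finite (\<Union>S \<union> U)" unfolding U_def using finite_span by simp
  qed (auto simp: U_def)
  ultimately have "card (span c) \<le> 3 * card S" using card_Un_le[of "\<Union>S" U] by linarith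
  then show ?thesis using S(1,2) unfolding E_def by (intro exI[of _ S] conjI)
qed

lemma clique_colouring_Diff:
  "clique_colouring V C (\<lambda>c u v. adj c u v \<and> u \<notin> R \<and> v \<notin> R)"
  using finite_V finite_C adj_in_V adj_sym adj_irrefl adj_trans by unfold_locales blast+

text \<open>Deleting \<open>R\<close> isolates at most one vertex of each clique, and only in cliques that meet \<open>R\<close>.\<close>

lemma card_span_Diff:
  "card (span c) \<le> card {v. \<exists>u. adj c u v \<and> u \<notin> R \<and> v \<notin> R} + 2 * card (R \<inter> span c)"
proof -
  define A where "A = {v. \<exists>u. adj c u v \<and> u \<notin> R \<and> v \<notin> R}"
  \<comment> \<open>Vertices isolated by the deletion. There are at most as many as deleted vertices
    of the class, whence the factor 2.\<close>
  define L where "L = span c - R - A"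
  have "\<exists>m. adj c m v" if "v \<in> L" for v using that unfolding L_def span_def by blast
  then obtain m where m: "\<And>v. v \<in> L \<Longrightarrow> adj c (m v) v" by metis
  have mR: "m v \<in> R \<inter> span c" if "v \<in> L" for v
    using m[OF that] that adj_sym unfolding L_def A_def span_def by blast
  have "inj_on m L"
  proof (rule inj_onI, rule ccontr)
    fix v v' assume v: "v \<in> L" "v' \<in> L" "m v = m v'" "v \<noteq> v'"
    then have "adj c v' v"
      using m[OF v(1)] adj_sym[OF m[OF v(2)]] adj_trans[of c v' "m v" v] by simp
    then show False using v(1,2) unfolding L_def A_def by blast
  qed
  then have "card L \<le> card (R \<inter> span c)"
    using mR finite_span by (intro card_inj_on_le[of m]) auto
  moreover have "card (span c) \<le> card (A \<union> (R \<inter> span c) \<union> L)"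
  proof (rule card_mono)
    have "A \<subseteq> span c" unfolding A_def span_def by blast
    then show "finite (A \<union> (R \<inter> span c) \<union> L)"
      using finite_span finite_subset unfolding L_def by auto
  qed (auto simp: L_def)
  ultimately show ?thesis
    using card_Un_le[of "A \<union> (R \<inter> span c)" L] card_Un_le[of A "R \<inter> span c"] unfolding A_def by linarith
qed

text \<open>Colours covered by \<open>M\<close> use pairs outside \<open>R\<close> and the missing
  colours use pairs inside \<open>R\<close>, so the two families cannot clash.\<close>

lemma rainbow_of_matching_and_choice:
  assumes max: "max_matching (triples C (\<lambda>c u v. adj c u v \<and> u \<notin> R \<and> v \<notin> R)) M"
    and g: "\<And>c. c \<in> C \<Longrightarrow> Inr c \<notin> \<Union>M \<Longrightarrow> g c \<subseteq> R"
      "\<And>c. c \<in> C \<Longrightarrow> Inr c \<notin> \<Union>M \<Longrightarrow> \<exists>u v. g c = {u, v} \<and> adj c u v"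
      "disjoint_family_on g {c \<in> C. Inr c \<notin> \<Union>M}"
  shows "\<exists>f. disjoint_family_on f C \<and> (\<forall>c \<in> C. \<exists>u v. f c = {u, v} \<and> adj c u v)"
proof -
  interpret D: maximum_colouring_matching V C "\<lambda>c u v. adj c u v \<and> u \<notin> R \<and> v \<notin> R" M 0
    using clique_colouring_Diff max
    by (simp add: maximum_colouring_matching_def maximum_colouring_matching_axioms_def)
  have "\<exists>h. h \<in> M \<and> Inr c \<in> h" if "Inr c \<in> \<Union>M" for c using that by blast
  then obtain t where t: "\<And>c. Inr c \<in> \<Union>M \<Longrightarrow> t c \<in> M \<and> Inr c \<in> t c" by metis
  define f where "f c = (if Inr c \<in> \<Union>M then {v. Inl v \<in> t c} else g c)" for c
  have f_matched: "\<exists>u v. t c = {Inl u, Inl v, Inr c} \<and> f c = {u, v} \<and> adj c u v \<and> f c \<inter> R = {}"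
    if c: "Inr c \<in> \<Union>M" for c
  proof -
    obtain u v c' where *: "t c = {Inl u, Inl v, Inr c'}" "adj c' u v \<and> u \<notin> R \<and> v \<notin> R"
      using D.M_E t[OF c] by metis
    then have "c' = c" "f c = {u, v}" using t[OF c] c unfolding f_def by auto
    then show ?thesis using * by auto
  qed
  have "disjoint_family_on f C"
    unfolding disjoint_family_on_def
  proof (intro ballI impI)
    fix c d assume cd: "c \<in> C" "d \<in> C" "c \<noteq> d"
    consider "Inr c \<in> \<Union>M" "Inr d \<in> \<Union>M" | "Inr c \<in> \<Union>M" "Inr d \<notin> \<Union>M"
      | "Inr c \<notin> \<Union>M" "Inr d \<in> \<Union>M" | "Inr c \<notin> \<Union>M" "Inr d \<notin> \<Union>M" by blast
    then show "f c \<inter> f d = {}"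
    proof cases
      case 1
      have "t c \<noteq> t d" using f_matched[OF 1(1)] f_matched[OF 1(2)] cd(3) by auto
      then have "t c \<inter> t d = {}" using disjointD[OF D.M_disjoint] t 1 by blast
      then show ?thesis using 1 unfolding f_def by auto
    next
      case 2
      have "f d \<subseteq> R" using g(1)[OF cd(2) 2(2)] 2(2) unfolding f_def by auto
      then show ?thesis using f_matched[OF 2(1)] by blast
    next
      case 3
      have "f c \<subseteq> R" using g(1)[OF cd(1) 3(1)] 3(1) unfolding f_def by auto
      then show ?thesis using f_matched[OF 3(2)] by blast
    next
      case 4
      then show ?thesis using g(3) cd unfolding f_def disjoint_family_on_def by auto
    qed
  qed
  moreover have "\<exists>u v. f c = {u, v} \<and> adj c u v" if c: "c \<in> C" for c
  proof (cases "Inr c \<in> \<Union>M")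
    case True
    then show ?thesis using f_matched by blast
  next
    case False
    then show ?thesis using g(2)[OF c] unfolding f_def by simp
  qed
  ultimately show ?thesis by blast
qed

end

lemma ex_rainbow_matching:
  fixes \<delta> :: real
  assumes \<delta>: "\<delta> > 0"
  shows "\<exists>n\<^sub>0. \<forall>V (C :: 'c set) (adj :: 'c \<Rightarrow> 'v \<Rightarrow> 'v \<Rightarrow> bool).
     clique_colouring V C adj \<longrightarrow> n\<^sub>0 \<le> card C \<longrightarrow>
     (\<forall>c \<in> C. (2 + \<delta>) * real (card C) \<le> real (card {v. \<exists>u. adj c u v})) \<longrightarrow>
     (\<forall>u v. real (card {c \<in> C. adj c u v}) \<le> sqrt (real (card C)) / (ln (real (card C)))\<^sup>2) \<longrightarrow>
     (\<exists>f. disjoint_family_on f C \<and> (\<forall>c \<in> C. \<exists>u v. f c = {u, v} \<and> adj c u v))"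
proof -
  have "\<delta> / 2 > 0" using \<delta> by simp
  from few_missing_colours[OF this] obtain K where K:
    "\<And>V (C :: 'c set) (adj :: 'c \<Rightarrow> 'v \<Rightarrow> 'v \<Rightarrow> bool) M \<mu>.
     clique_colouring V C adj \<Longrightarrow> max_matching (triples C adj) M \<Longrightarrow>
     \<forall>c \<in> C. (2 + \<delta> / 2) * real (card C) \<le> real (card {v. \<exists>u. adj c u v}) \<Longrightarrow>
     1 \<le> \<mu> \<Longrightarrow> \<forall>u v. real (card {c \<in> C. adj c u v}) \<le> \<mu> \<Longrightarrow>
     real (card C - card M) \<le> K * \<mu>"
    by blast
  define k where "k = \<bar>K\<bar> + 1"
  have k: "k > 0" "K \<le> k" unfolding k_def by auto
  \<comment> \<open>A class loses at most twice its share of \<open>R\<close>, a fraction of at most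
    \<open>8 * p\<close>. This \<open>p\<close> makes the loss \<open>\<delta> / 2 * n\<close> for a
    class of \<open>(2 + \<delta>) * n\<close> vertices.\<close>
  define p where "p = \<delta> / (16 * (2 + \<delta>))"
  have p: "0 < p" "p \<le> 1" "8 * p * (2 + \<delta>) = \<delta> / 2"
    using \<delta> unfolding p_def by (auto simp: field_simps)
  \<comment> \<open>With \<open>m = 2 * n\<close> the moment for the pairs is
    \<open>exp (- 2 * r * n)\<close>, so \<open>2 ^ y\<close> may grow up to
    \<open>exp (r * n)\<close>.\<close>
  define r where "r = p\<^sup>2 / 6"
  have r: "0 < r" using p unfolding r_def by simp
  have "\<forall>\<^sub>F n in sequentially. 2 * k * (1 + sqrt (real n) / (ln (real n))\<^sup>2) + 1 \<le> r * real n"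
    using k(1) r by real_asymp
  moreover have "\<forall>\<^sub>F n in sequentially. real n * (exp (- p * (2 * real n)) + exp (- r * real n)) < 1"
  proof -
    have "\<forall>\<^sub>F n in sequentially. real n * exp (- p * (2 * real n)) < 1 / 2"
      using p(1) by real_asymp
    moreover have "\<forall>\<^sub>F n in sequentially. real n * exp (- r * real n) < 1 / 2"
      using r by real_asymp
    ultimately show ?thesis by eventually_elim (simp add: distrib_left)
  qed
  ultimately have "\<forall>\<^sub>F n in sequentially.
      2 * k * (1 + sqrt (real n) / (ln (real n))\<^sup>2) + 1 \<le> r * real n \<and>
      real n * (exp (- p * (2 * real n)) + exp (- r * real n)) < 1"
    by (rule eventually_conj)
  then obtain n\<^sub>0 where n\<^sub>0: "\<And>n. n\<^sub>0 \<le> n \<Longrightarrow>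
      2 * k * (1 + sqrt (real n) / (ln (real n))\<^sup>2) + 1 \<le> r * real n \<and>
      real n * (exp (- p * (2 * real n)) + exp (- r * real n)) < 1"
    unfolding eventually_sequentially by blast
  have main: "\<exists>f. disjoint_family_on f C \<and> (\<forall>c \<in> C. \<exists>u v. f c = {u, v} \<and> adj c u v)"
    if cl: "clique_colouring V C adj" and n: "n\<^sub>0 \<le> card C"
      and sp: "\<forall>c \<in> C. (2 + \<delta>) * real (card C) \<le> real (card {v. \<exists>u. adj c u v})"
      and mult: "\<forall>u v. real (card {c \<in> C. adj c u v}) \<le> sqrt (real (card C)) / (ln (real (card C)))\<^sup>2"
    for V and C :: "'c set" and adj :: "'c \<Rightarrow> 'v \<Rightarrow> 'v \<Rightarrow> bool"
  proof -
    interpret clique_colouring V C adj by (rule cl)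
    define n where "n = real (card C)"
    \<comment> \<open>The summand 1 ensures \<open>1 \<le> \<mu>\<close>, as the bound on missing
      colours demands; \<mu> is still \<open>o(n)\<close>.\<close>
    define \<mu> where "\<mu> = 1 + sqrt n / (ln n)\<^sup>2"
    have \<mu>: "1 \<le> \<mu>" "\<forall>u v. real (card {c \<in> C. adj c u v}) \<le> \<mu>"
      using mult unfolding \<mu>_def n_def by (simp, smt (verit))
    have small: "2 * k * \<mu> + 1 \<le> r * n" "n * (exp (- p * (2 * n)) + exp (- r * n)) < 1"
      unfolding \<mu>_def n_def using n\<^sub>0[OF n] by blast+
    \<comment> \<open>At most \<open>k * \<mu>\<close> colours will be missing, and the greedy
      choice asks for two disjoint pairs per missing colour.\<close>
    define y where "y = nat \<lceil>2 * k * \<mu>\<rceil>"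
    have kmu: "0 \<le> 2 * k * \<mu>" using k(1) \<mu>(1) by simp
    have y: "2 * k * \<mu> \<le> real y" "real y \<le> r * n"
      using kmu small(1) unfolding y_def by linarith+
    have span: "(2 + \<delta>) * n \<le> real (card (span c))" if "c \<in> C" for c
      using sp that unfolding n_def span_def by blast
    have span2: "2 * n \<le> real (card (span c))" if "c \<in> C" for c
    proof -
      have "2 * n \<le> (2 + \<delta>) * n" using \<delta> unfolding n_def by (intro mult_right_mono) auto
      then show ?thesis using span[OF that] by linarith
    qed
    obtain S where "\<forall>c. S c \<subseteq> {{u, v} | u v. adj c u v} \<and> disjoint (S c) \<and>
        card (span c) \<le> 3 * card (S c)"
      using choice[OF allI[OF ex_disjoint_pairs]] ..
    then have S: "S c \<subseteq> {{u, v} | u v. adj c u v}" "disjoint (S c)"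
        "card (span c) \<le> 3 * card (S c)" for c by simp_all
    have two: "card e = 2" if "e \<in> S c" for c e
      using subsetD[OF S(1) that] card_adj by auto
    have SV: "\<Union>(S c) \<subseteq> V" for c
      using S(1)[of c] adj_in_V adj_in_V2 by fastforce
    have S3: "2 * n / 3 \<le> real (card (S c))" if "c \<in> C" for c
      using S(3)[of c] span2[OF that] by linarith
    have "(2::real) ^ y \<le> exp 1 ^ y" using exp_ge_add_one_self[of 1] by (intro power_mono) auto
    also have "\<dots> = exp (real y)" by (simp add: exp_of_nat_mult[symmetric])
    also have "\<dots> \<le> exp (r * n)" using y(2) by simp
    finally have "2 ^ y * exp (- p\<^sup>2 * (2 * n) / 6) \<le> exp (r * n) * exp (- p\<^sup>2 * (2 * n) / 6)"
      by (intro mult_right_mono) auto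
    also have "\<dots> = exp (- r * n)" unfolding r_def by (simp add: exp_add[symmetric])
    finally have "n * (exp (- p * (2 * n)) + 2 ^ y * exp (- p\<^sup>2 * (2 * n) / 6)) \<le>
        n * (exp (- p * (2 * n)) + exp (- r * n))"
      unfolding n_def by (intro mult_left_mono) auto
    then have yy: "real (card C) * (exp (- p * (2 * n)) + 2 ^ y * exp (- p\<^sup>2 * (2 * n) / 6)) < 1"
      using small(2) unfolding n_def by linarith
    have n0: "0 \<le> 2 * n" unfolding n_def by simp
    have "\<exists>R \<subseteq> V. \<forall>c \<in> C. real (card (R \<inter> span c)) \<le> 4 * p * real (card (span c)) \<and>
        y \<le> card {e \<in> S c. e \<subseteq> R}"
    proof (rule ex_sparse_set_with_many_pairs[OF finite_V finite_C p(1,2) n0])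
      fix c assume "c \<in> C"
      then show "2 * n \<le> real (card (span c))" "2 * n / 3 \<le> real (card (S c))"
        by (rule span2, rule S3)
    qed (rule yy span_subset SV S(2) two, assumption?)+
    then obtain R where R: "\<forall>c \<in> C. real (card (R \<inter> span c)) \<le> 4 * p * real (card (span c)) \<and>
        y \<le> card {e \<in> S c. e \<subseteq> R}" by blast
    define adj' where "adj' = (\<lambda>c u v. adj c u v \<and> u \<notin> R \<and> v \<notin> R)"
    have cl': "clique_colouring V C adj'"
      using clique_colouring_Diff[of R] unfolding adj'_def .
    obtain M where M: "max_matching (triples C adj') M"
      by (rule ex_max_matching[OF clique_colouring.finite_triples[OF cl'] clique_colouring.card_triple[OF cl']])
    \<comment> \<open>The threshold \<open>b\<close> gets the placeholder value 0: only the count of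
      missing colours is taken from here.\<close>
    interpret D: maximum_colouring_matching V C adj' M 0
      using cl' M by (simp add: maximum_colouring_matching_def maximum_colouring_matching_axioms_def)
    have "(2 + \<delta> / 2) * real (card C) \<le> real (card {v. \<exists>u. adj' c u v})" if c: "c \<in> C" for c
    proof -
      have "real (card (span c)) \<le> real (card {v. \<exists>u. adj' c u v}) + 2 * real (card (R \<inter> span c))"
        using card_span_Diff[of c R] unfolding adj'_def by linarith
      then have "(1 - 8 * p) * real (card (span c)) \<le> real (card {v. \<exists>u. adj' c u v})"
        using bspec[OF R c] by (simp add: algebra_simps)
      moreover have "(1 - 8 * p) * ((2 + \<delta>) * n) \<le> (1 - 8 * p) * real (card (span c))"
      proof (rule mult_left_mono[OF span[OF c]])
        have "8 * p \<le> 1" unfolding p_def using \<delta> by (simp add: field_simps)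
        then show "0 \<le> 1 - 8 * p" by simp
      qed
      moreover have "(1 - 8 * p) * ((2 + \<delta>) * n) = (2 + \<delta>) * n - (8 * p * (2 + \<delta>)) * n"
        by (simp add: algebra_simps)
      ultimately have "(2 + \<delta>) * n - \<delta> / 2 * n \<le> real (card {v. \<exists>u. adj' c u v})"
        unfolding p(3) by linarith
      moreover have "(2 + \<delta> / 2) * real (card C) = (2 + \<delta>) * n - \<delta> / 2 * n"
        unfolding n_def by (simp add: algebra_simps)
      ultimately show ?thesis by simp
    qed
    moreover have "real (card {c \<in> C. adj' c u v}) \<le> \<mu>" for u v
    proof -
      have "card {c \<in> C. adj' c u v} \<le> card {c \<in> C. adj c u v}"
        unfolding adj'_def using finite_C by (intro card_mono) auto
      then show ?thesis using \<mu>(2)[rule_format, of u v] by linarith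
    qed
    ultimately have "real (card C - card M) \<le> K * \<mu>" using \<mu>(1) by (intro K[OF cl' M]) auto
    also have "\<dots> \<le> k * \<mu>" using k(2) \<mu>(1) by (intro mult_right_mono) auto
    finally have few: "2 * card {c \<in> C. Inr c \<notin> \<Union>M} \<le> y"
      using y(1) unfolding D.card_missing by linarith
    have "\<exists>g. (\<forall>c \<in> {c \<in> C. Inr c \<notin> \<Union>M}. g c \<in> {e \<in> S c. e \<subseteq> R}) \<and>
        disjoint_family_on g {c \<in> C. Inr c \<notin> \<Union>M}"
    proof (intro ex_disjoint_choice)
      fix c assume "c \<in> {c \<in> C. Inr c \<notin> \<Union>M}"
      then have "y \<le> card {e \<in> S c. e \<subseteq> R}" using R by simp
      then show "2 * card {c \<in> C. Inr c \<notin> \<Union>M} \<le> card {e \<in> S c. e \<subseteq> R}" using few by simp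
      show "disjoint {e \<in> S c. e \<subseteq> R}" using S(2)[of c] by (rule pairwise_subset) blast
    qed (use two finite_C in auto)
    then obtain g where g: "\<And>c. c \<in> C \<Longrightarrow> Inr c \<notin> \<Union>M \<Longrightarrow> g c \<in> S c \<and> g c \<subseteq> R"
        "disjoint_family_on g {c \<in> C. Inr c \<notin> \<Union>M}" by blast
    show ?thesis
    proof (rule rainbow_of_matching_and_choice[OF M[unfolded adj'_def] _ _ g(2)])
      fix c assume "c \<in> C" "Inr c \<notin> \<Union>M"
      then show "g c \<subseteq> R" "\<exists>u v. g c = {u, v} \<and> adj c u v"
        using g(1) S(1)[of c] by blast+
    qed
  qed
  show ?thesis by (intro exI[of _ n\<^sub>0] allI impI) (rule main)
qed

subsection \<open>Multigraphs\<close>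

definition colour_adj ::
  "('v, 'e) pre_multigraph \<Rightarrow> ('e \<Rightarrow> 'c) \<Rightarrow> 'c \<Rightarrow> 'v \<Rightarrow> 'v \<Rightarrow> bool" where
  "colour_adj G col c u v \<longleftrightarrow> (\<exists>e \<in> edges G. col e = c \<and> ends G e = {u, v})"

text \<open>The cliques containing the two edges share \<open>v\<close>, so they coincide. This
  clique joins \<open>u\<close> to \<open>w\<close>, and all its edges have colour
  \<open>c\<close>.\<close>

lemma colour_adj_trans:
  assumes cl: "disjoint_union_of_nontrivial_cliques (colour_class G col c)"
    and uv: "colour_adj G col c u v" and vw: "colour_adj G col c v w" and "u \<noteq> w"
  shows "colour_adj G col c u w"
proof -
  obtain \<K> where \<K>: "is_disjoint_union (colour_class G col c) \<K>" "\<And>K. K \<in> \<K> \<Longrightarrow> nontrivial_clique K"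
    using cl unfolding disjoint_union_of_nontrivial_cliques_def by blast
  have ends: "ends K = ends G" if "K \<in> \<K>" for K
    using \<K>(1) that unfolding is_disjoint_union_def colour_class_def by simp
  have edges: "{e \<in> edges G. col e = c} = (\<Union>K\<in>\<K>. edges K)"
    using \<K>(1) unfolding is_disjoint_union_def colour_class_def by simp
  have clique: "\<exists>K \<in> \<K>. x \<in> verts K \<and> y \<in> verts K" if xy: "colour_adj G col c x y" for x y
  proof -
    obtain e where e: "e \<in> {e \<in> edges G. col e = c}" "ends G e = {x, y}"
      using xy unfolding colour_adj_def by blast
    then obtain K where K: "K \<in> \<K>" "e \<in> edges K" unfolding edges by blast
    have "multigraph K" using \<K>(2)[OF K(1)] unfolding nontrivial_clique_def by blast
    then have "ends K e \<subseteq> verts K" using K(2) by (rule multigraph.ends_subset_verts)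
    then show ?thesis using K(1) e(2) ends by auto
  qed
  obtain K K' where K: "K \<in> \<K>" "u \<in> verts K" "v \<in> verts K" "K' \<in> \<K>" "v \<in> verts K'" "w \<in> verts K'"
    using clique[OF uv] clique[OF vw] by blast
  have "K = K'"
    using \<K>(1) K(1,3,4,5) unfolding is_disjoint_union_def disjoint_family_on_def by blast
  then obtain e where "e \<in> edges_joining K u w"
    using \<K>(2)[OF K(1)] K \<open>u \<noteq> w\<close> unfolding nontrivial_clique_def by blast
  then have "e \<in> edges K" "ends G e = {u, w}"
    using ends[OF K(1)] unfolding edges_joining_def by auto
  then show ?thesis using edges K(1) unfolding colour_adj_def by blast
qed

lemma clique_colouring_colour_adj:
  assumes G: "multigraph G" and "finite C" "col ` edges G \<subseteq> C"
    and cl: "\<And>c. c \<in> C \<Longrightarrow> disjoint_union_of_nontrivial_cliques (colour_class G col c)"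
  shows "clique_colouring (verts G) C (colour_adj G col)"
proof
  show "finite (verts G)" using G by (rule multigraph.finite_verts)
  show "finite C" by fact
  fix c u v
  show "colour_adj G col c u v \<Longrightarrow> u \<in> verts G"
    using multigraph.ends_subset_verts[OF G] unfolding colour_adj_def by blast
  show "colour_adj G col c u v \<Longrightarrow> colour_adj G col c v u"
    unfolding colour_adj_def by (simp add: insert_commute)
  show "\<not> colour_adj G col c u u"
    using multigraph.card_ends[OF G] unfolding colour_adj_def by fastforce
  fix w assume a: "colour_adj G col c u v" "colour_adj G col c v w" "u \<noteq> w"
  then have "c \<in> C" using assms(3) unfolding colour_adj_def by blast
  then show "colour_adj G col c u w" using colour_adj_trans[OF cl a] by blast
qed

lemma verts_colour_class:
  assumes "multigraph G"
  shows "verts (colour_class G col c) = {v. \<exists>u. colour_adj G col c u v}"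
proof (intro equalityI subsetI)
  fix v assume "v \<in> verts (colour_class G col c)"
  then obtain e where e: "e \<in> edges G" "col e = c" "v \<in> ends G e"
    unfolding colour_class_def by auto
  obtain a b where "ends G e = {a, b}"
    using multigraph.card_ends[OF assms e(1)] by (auto simp: card_2_iff)
  then show "v \<in> {v. \<exists>u. colour_adj G col c u v}"
    using e unfolding colour_adj_def by (auto simp: insert_commute)
qed (auto simp: colour_class_def colour_adj_def)

text \<open>Every colour in which \<open>u\<close> and \<open>v\<close> are adjacent is the colour
  of one of the parallel edges joining them. If there is none, which includes \<open>u = v\<close>
  and vertices outside \<open>G\<close>, the count is 0.\<close>

lemma card_colours_joining_le:
  assumes G: "multigraph G" and "0 \<le> m"
    and mult: "\<And>u v. u \<in> verts G \<Longrightarrow> v \<in> verts G \<Longrightarrow> u \<noteq> v \<Longrightarrow> real (card (edges_joining G u v)) \<le> m"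
  shows "real (card {c \<in> C. colour_adj G col c u v}) \<le> m"
proof (cases "\<exists>c. colour_adj G col c u v")
  case True
  then obtain e where e: "e \<in> edges G" "ends G e = {u, v}" unfolding colour_adj_def by blast
  have "u \<in> verts G" "v \<in> verts G" "u \<noteq> v"
    using multigraph.ends_subset_verts[OF G e(1)] multigraph.card_ends[OF G e(1)] e(2) by auto
  moreover have "card {c \<in> C. colour_adj G col c u v} \<le> card (edges_joining G u v)"
  proof (rule surj_card_le)
    show "finite (edges_joining G u v)"
      using multigraph.finite_edges[OF G] unfolding edges_joining_def by simp
    show "{c \<in> C. colour_adj G col c u v} \<subseteq> col ` edges_joining G u v"
      unfolding colour_adj_def edges_joining_def by blast
  qed
  ultimately show ?thesis using mult by (meson of_nat_le_iff order_trans)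
qed (use assms(2) in simp)

text \<open>Choose for every colour an edge realising its pair; the choice is injective because
  \<open>col\<close> recovers the colour.\<close>

lemma ex_full_rainbow_matching:
  assumes f: "disjoint_family_on f C" "\<And>c. c \<in> C \<Longrightarrow> \<exists>u v. f c = {u, v} \<and> colour_adj G col c u v"
  shows "\<exists>M. full_rainbow_matching G col (card C) M"
proof -
  have "\<exists>e. e \<in> edges G \<and> col e = c \<and> ends G e = f c" if "c \<in> C" for c
    using f(2)[OF that] unfolding colour_adj_def by metis
  then obtain e where e: "\<And>c. c \<in> C \<Longrightarrow> e c \<in> edges G \<and> col (e c) = c \<and> ends G (e c) = f c" by metis
  have "inj_on e C" using e by (intro inj_onI) metis
  then have "card (e ` C) = card C" by (rule card_image)
  moreover have "disjoint_family_on (ends G) (e ` C)"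
    using f(1) e unfolding disjoint_family_on_def by fastforce
  moreover have "inj_on col (e ` C)" using e by (intro inj_onI) auto
  ultimately show ?thesis
    using e unfolding full_rainbow_matching_def by (intro exI[of _ "e ` C"]) auto
qed

theorem theorem1:
  fixes \<delta> :: real
  assumes "\<delta> > 0"
  shows "\<exists>n\<^sub>0 :: nat. \<forall>n \<ge> n\<^sub>0.
    \<forall>(G :: ('v, 'e) pre_multigraph) (col :: 'e \<Rightarrow> 'c) (C :: 'c set).
      multigraph G \<longrightarrow>
      finite C \<longrightarrow> card C = n \<longrightarrow> col ` edges G \<subseteq> C \<longrightarrow>
      (\<forall>c \<in> C. disjoint_union_of_nontrivial_cliques (colour_class G col c) \<and>
               real (card (verts (colour_class G col c))) \<ge> (2 + \<delta>) * real n) \<longrightarrow>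
      (\<forall>u \<in> verts G. \<forall>v \<in> verts G. u \<noteq> v \<longrightarrow>
         real (card (edges_joining G u v)) \<le> sqrt (real n) / (ln (real n))\<^sup>2) \<longrightarrow>
      (\<exists>M. full_rainbow_matching G col n M)"
proof -
  obtain n\<^sub>0 where n\<^sub>0: "\<forall>V (C :: 'c set) (adj :: 'c \<Rightarrow> 'v \<Rightarrow> 'v \<Rightarrow> bool).
     clique_colouring V C adj \<longrightarrow> n\<^sub>0 \<le> card C \<longrightarrow>
     (\<forall>c \<in> C. (2 + \<delta>) * real (card C) \<le> real (card {v. \<exists>u. adj c u v})) \<longrightarrow>
     (\<forall>u v. real (card {c \<in> C. adj c u v}) \<le> sqrt (real (card C)) / (ln (real (card C)))\<^sup>2) \<longrightarrow>
     (\<exists>f. disjoint_family_on f C \<and> (\<forall>c \<in> C. \<exists>u v. f c = {u, v} \<and> adj c u v))"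
    using ex_rainbow_matching[OF assms] ..
  show ?thesis
  proof (intro exI[of _ n\<^sub>0] allI impI)
    fix n and G :: "('v, 'e) pre_multigraph" and col :: "'e \<Rightarrow> 'c" and C
    assume n: "n\<^sub>0 \<le> n" and G: "multigraph G" and C: "finite C" "card C = n" "col ` edges G \<subseteq> C"
      and cl: "\<forall>c \<in> C. disjoint_union_of_nontrivial_cliques (colour_class G col c) \<and>
               real (card (verts (colour_class G col c))) \<ge> (2 + \<delta>) * real n"
      and mult: "\<forall>u \<in> verts G. \<forall>v \<in> verts G. u \<noteq> v \<longrightarrow>
         real (card (edges_joining G u v)) \<le> sqrt (real n) / (ln (real n))\<^sup>2"
    have "\<exists>f. disjoint_family_on f C \<and> (\<forall>c \<in> C. \<exists>u v. f c = {u, v} \<and> colour_adj G col c u v)"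
    proof (rule n\<^sub>0[THEN spec, THEN spec, THEN spec, THEN mp, THEN mp, THEN mp, THEN mp])
      show "clique_colouring (verts G) C (colour_adj G col)"
        using G C cl by (intro clique_colouring_colour_adj) auto
      show "n\<^sub>0 \<le> card C" using n C(2) by simp
      show "\<forall>c \<in> C. (2 + \<delta>) * real (card C) \<le> real (card {v. \<exists>u. colour_adj G col c u v})"
        using cl C(2) by (simp add: verts_colour_class[OF G])
      show "\<forall>u v. real (card {c \<in> C. colour_adj G col c u v}) \<le>
          sqrt (real (card C)) / (ln (real (card C)))\<^sup>2"
        unfolding C(2) using mult by (intro allI card_colours_joining_le[OF G]) auto
    qed
    then show "\<exists>M. full_rainbow_matching G col n M"
      using ex_full_rainbow_matching[of _ C G col] unfolding C(2) by blast
  qed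
qed

end
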